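(* Let $\mathcal{R}:\mathbb{R}^V\to\mathbb{R}^V$ be the residual function defined in the context, with $\mathcal{H}$ satisfying (H1), (H2) and (H4) (with constant $\underline\alpha>0$). Let $\bar u$ be such that $\mathcal{R}(\bar u)=0$. Then, for any $u\in\mathbb{R}^V$, $$\|u-\bar u\|_{\ell^\infty(V)}\le C\,\|\mathcal{R}(u)\|_{\ell^\infty(V)},\qquad C:=\frac{\Delta x_{\max}}{\underline\alpha}\Big(2+\frac{\overline s}{\underline\alpha}\frac{\Delta x_{\max}}{\Delta x_{\min}}\Big)^{d_\infty}+\frac{1}{\lambda_b}.$$
   Context: Setting. $V$ is a finite index set, $\{x_j\}_{j\in V}$ are nodes which are the vertices of a directed graph; $\mathcal{V}_j\subset V$ is the set of (out-)neighbors of $j$, with $j\notin\mathcal{V}_j$. Put $\mathcal{J}:=\{j\in V:\mathcal{V}_j\neq\emptyset\}$ and $\mathcal{B}:=\{j\in V:\mathcal{V}_j=\emptyset\}$, both assumed non-empty. For $k\in\mathcal{V}_j$, $\Delta x_{jk}>0$ is the distance between $x_j$ and $x_k$. For $u\in\mathbb{R}^V$ and $j\in\mathcal{J}$, $\nabla_G u_j:=\{(u_j-u_k)/\Delta x_{jk}\}_{k\in\mathcal{V}_j}\in\mathbb{R}^{|\mathcal{V}_j|}$. For each $j\in\mathcal{J}$ a numerical Hamiltonian $\mathcal{H}(x_j,\cdot,\cdot):\mathbb{R}\times\mathbb{R}^{|\mathcal{V}_j|}\to\mathbb{R}$ is given; the components of its last variable $p$ are indexed by $k\in\mathcal{V}_j$.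 Boundary values $\{g_j\}_{j\in\mathcal{B}}$ are given. $\|u\|_{\ell^\infty(V)}:=\max_{j\in V}|u_j|$. Residual: for a constant $\lambda_b>0$, $\mathcal{R}(u)_j:=\mathcal{H}(x_j,u_j,\nabla_G u_j)$ for $j\in\mathcal{J}$ and $\mathcal{R}(u)_j:=\lambda_b(u_j-g_j)$ for $j\in\mathcal{B}$. Hypotheses. (H1) There are constants $[\mathcal{H}]_u,[\mathcal{H}]_p>0$, independent of $x_j$, such that $|\mathcal{H}(x_j,u,p)-\mathcal{H}(x_j,v,p)|\le[\mathcal{H}]_u|u-v|$ and $|\mathcal{H}(x_j,u,p)-\mathcal{H}(x_j,u,q)|\le[\mathcal{H}]_p\|p-q\|_\infty$ for all $j\in\mathcal{J}$, $u,v\in\mathbb{R}$, $p,q\in\mathbb{R}^{|\mathcal{V}_j|}$. (H2) For all $j\in\mathcal{J}$, $u,v\in\mathbb{R}$, $p,q\in\mathbb{R}^{|\mathcal{V}_j|}$: $p\le q$ componentwise implies $\mathcal{H}(x_j,u,p)\le\mathcal{H}(x_j,u,q)$; and $u\le v$ implies $\mathcal{H}(x_j,u,p)\le\mathcal{H}(x_j,v,p)$. (H4) (i) There is $\underline\alpha>0$ such that for all $j\in\mathcal{J}$, $u\in\mathbb{R}$, $k\in\mathcal{V}_j$: $\frac{\partial\mathcal{H}}{\partial p_k}(x_j,u,p)\ge\underline\alpha$ for a.e. $p\in\mathbb{R}^{|\mathcal{V}_j|}$. (ii) For any $j\in\mathcal{J}$ there are $n\in\mathbb{N}$, $(j_1,\dots,j_n)\in\mathcal{J}^n$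 and $j_{n+1}\in\mathcal{B}$ with $j_1=j$ and $j_{k+1}\in\mathcal{V}_{j_k}$ for $k=1,\dots,n$. (iii) For any $j,k\in\mathcal{J}$: $j\in\mathcal{V}_k$ if and only if $k\in\mathcal{V}_j$. Constants. For $j\in\mathcal{J}$, $d_j$ is the smallest $n$ for which a path as in (H4)(ii) starting at $j$ exists; $d_j:=0$ for $j\in\mathcal{B}$; $d_\infty:=\max_{j\in\mathcal{J}}d_j$. $\overline s:=\operatorname{ess\,sup}_{j,u,p}\sum_{k\in\mathcal{V}_j}\frac{\partial\mathcal{H}}{\partial p_k}(x_j,u,p)$. $\Delta x_{\min}$ and $\Delta x_{\max}$ are the minimum and maximum of $\Delta x_{jk}$ over $j\in\mathcal{J}$, $k\in\mathcal{V}_j$. *)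

theory Defs
  imports "HOL-Probability.Essential_Supremum"
begin

text \<open>
  The index set is a finite type \<open>'v\<close>; \<open>N j\<close> is the set of out-neighbours of \<open>j\<close> and \<open>dx j k\<close> the
  distance along the edge from \<open>j\<close> to \<open>k\<close>.  A vector in the space \<open>\<real>\<^bsup>N j\<^esup>\<close> is an extensional function
  \<open>p \<in> N j \<rightarrow>\<^sub>E UNIV\<close>, so that this space is the underlying set of the product measure
  \<open>\<Pi>\<^sub>M k\<in>N j. lborel\<close>.  Values of a Hamiltonian \<open>H j u p\<close> outside this carrier play no role.
\<close>

type_synonym 'v hamiltonian = "'v \<Rightarrow> real \<Rightarrow> ('v \<Rightarrow> real) \<Rightarrow> real"

definition inner_nodes :: "('v \<Rightarrow> 'v set) \<Rightarrow> 'v set" where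
  "inner_nodes N = {j. N j \<noteq> {}}"

definition bdry_nodes :: "('v \<Rightarrow> 'v set) \<Rightarrow> 'v set" where
  "bdry_nodes N = {j. N j = {}}"

definition gradG ::
  "('v \<Rightarrow> 'v set) \<Rightarrow> ('v \<Rightarrow> 'v \<Rightarrow> real) \<Rightarrow> ('v \<Rightarrow> real) \<Rightarrow> 'v \<Rightarrow> ('v \<Rightarrow> real)" where
  "gradG N dx u j = (\<lambda>k\<in>N j. (u j - u k) / dx j k)"

definition linf_norm :: "('v::finite \<Rightarrow> real) \<Rightarrow> real" where
  "linf_norm w = (MAX j. \<bar>w j\<bar>)"

definition residual ::
  "('v \<Rightarrow> 'v set) \<Rightarrow> ('v \<Rightarrow> 'v \<Rightarrow> real) \<Rightarrow> 'v hamiltonian \<Rightarrow> real \<Rightarrow> ('v \<Rightarrow> real)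
     \<Rightarrow> ('v \<Rightarrow> real) \<Rightarrow> ('v \<Rightarrow> real)" where
  "residual N dx H lb g u =
     (\<lambda>j. if j \<in> inner_nodes N then H j (u j) (gradG N dx u j) else lb * (u j - g j))"

definition H1 :: "('v \<Rightarrow> 'v set) \<Rightarrow> 'v hamiltonian \<Rightarrow> bool" where
  "H1 N H \<longleftrightarrow> (\<exists>Lu Lp. Lu > 0 \<and> Lp > 0 \<and>
     (\<forall>j\<in>inner_nodes N. \<forall>u v. \<forall>p\<in>N j \<rightarrow>\<^sub>E UNIV. \<bar>H j u p - H j v p\<bar> \<le> Lu * \<bar>u - v\<bar>) \<and>
     (\<forall>j\<in>inner_nodes N. \<forall>u. \<forall>p\<in>N j \<rightarrow>\<^sub>E UNIV. \<forall>q\<in>N j \<rightarrow>\<^sub>E UNIV.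
        \<bar>H j u p - H j u q\<bar> \<le> Lp * (MAX k\<in>N j. \<bar>p k - q k\<bar>)))"

definition H2 :: "('v \<Rightarrow> 'v set) \<Rightarrow> 'v hamiltonian \<Rightarrow> bool" where
  "H2 N H \<longleftrightarrow>
     (\<forall>j\<in>inner_nodes N. \<forall>u. \<forall>p\<in>N j \<rightarrow>\<^sub>E UNIV. \<forall>q\<in>N j \<rightarrow>\<^sub>E UNIV.
        (\<forall>k\<in>N j. p k \<le> q k) \<longrightarrow> H j u p \<le> H j u q) \<and>
     (\<forall>j\<in>inner_nodes N. \<forall>u v. \<forall>p\<in>N j \<rightarrow>\<^sub>E UNIV. u \<le> v \<longrightarrow> H j u p \<le> H j v p)"

definition partial_p :: "'v hamiltonian \<Rightarrow> 'v \<Rightarrow> real \<Rightarrow> ('v \<Rightarrow> real) \<Rightarrow> 'v \<Rightarrow> real" where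
  "partial_p H j u p k = deriv (\<lambda>t. H j u (p(k := t))) (p k)"

text \<open>
  \<open>deriv\<close> is total, so the existence of the partial derivative at almost every point is stated
  explicitly; for a Hamiltonian that is Lipschitz in \<open>p\<close> this is automatic.
\<close>

definition H4i :: "('v \<Rightarrow> 'v set) \<Rightarrow> 'v hamiltonian \<Rightarrow> real \<Rightarrow> bool" where
  "H4i N H \<alpha> \<longleftrightarrow> (\<forall>j\<in>inner_nodes N. \<forall>u. \<forall>k\<in>N j.
     AE p in (\<Pi>\<^sub>M k\<in>N j. lborel).
       (\<lambda>t. H j u (p(k := t))) differentiable (at (p k)) \<and> partial_p H j u p k \<ge> \<alpha>)"

text \<open>
  \<open>exit_path N j n\<close>: there is a path \<open>js 1, \<dots>, js (n + 1)\<close> starting at \<open>j\<close> whose first \<open>n \<ge> 1\<close> nodes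
  are inner nodes and whose last node is a boundary node.
\<close>

definition exit_path :: "('v \<Rightarrow> 'v set) \<Rightarrow> 'v \<Rightarrow> nat \<Rightarrow> bool" where
  "exit_path N j n \<longleftrightarrow> n \<ge> 1 \<and> (\<exists>js :: nat \<Rightarrow> 'v.
     js 1 = j \<and> (\<forall>k\<in>{1..n}. js k \<in> inner_nodes N) \<and> js (n + 1) \<in> bdry_nodes N \<and>
     (\<forall>k\<in>{1..n}. js (k + 1) \<in> N (js k)))"

definition H4ii :: "('v \<Rightarrow> 'v set) \<Rightarrow> bool" where
  "H4ii N \<longleftrightarrow> (\<forall>j\<in>inner_nodes N. \<exists>n. exit_path N j n)"

definition H4iii :: "('v \<Rightarrow> 'v set) \<Rightarrow> bool" where
  "H4iii N \<longleftrightarrow> (\<forall>j\<in>inner_nodes N. \<forall>k\<in>inner_nodes N. j \<in> N k \<longleftrightarrow> k \<in> N j)"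

definition bdry_dist :: "('v \<Rightarrow> 'v set) \<Rightarrow> 'v \<Rightarrow> nat" where
  "bdry_dist N j = (if j \<in> inner_nodes N then (LEAST n. exit_path N j n) else 0)"

definition d_inf :: "('v \<Rightarrow> 'v set) \<Rightarrow> nat" where
  "d_inf N = (MAX j\<in>inner_nodes N. bdry_dist N j)"

text \<open>
  The essential supremum over \<open>(j, u, p)\<close> is with respect to the counting measure in \<open>j\<close> (hence the
  plain supremum over the finite set of inner nodes) and Lebesgue measure in \<open>(u, p)\<close>.  Under
  \<open>H1\<close> and \<open>H4i\<close> the integrand is Borel (\<open>H j\<close> is continuous, and \<open>deriv\<close> is one fixed constant where
  the derivative fails to exist), so \<open>esssup\<close> does not take its default value \<open>top\<close>; and its value
  in \<open>ereal\<close> is finite, so nothing is lost by \<open>real_of_ereal\<close>.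
\<close>

definition s_bar :: "('v \<Rightarrow> 'v set) \<Rightarrow> 'v hamiltonian \<Rightarrow> real" where
  "s_bar N H = real_of_ereal (SUP j\<in>inner_nodes N.
     esssup (lborel \<Otimes>\<^sub>M (\<Pi>\<^sub>M k\<in>N j. lborel))
       (\<lambda>(u, p). ereal (\<Sum>k\<in>N j. partial_p H j u p k)))"

definition dx_min :: "('v \<Rightarrow> 'v set) \<Rightarrow> ('v \<Rightarrow> 'v \<Rightarrow> real) \<Rightarrow> real" where
  "dx_min N dx = Min {dx j k | j k. j \<in> inner_nodes N \<and> k \<in> N j}"

definition dx_max :: "('v \<Rightarrow> 'v set) \<Rightarrow> ('v \<Rightarrow> 'v \<Rightarrow> real) \<Rightarrow> real" where
  "dx_max N dx = Max {dx j k | j k. j \<in> inner_nodes N \<and> k \<in> N j}"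

end

theory Submission
  imports Defs
begin

text \<open>
  The proof is a quantitative discrete maximum principle.  Let \<open>m\<close> be the maximum of \<open>u - ubar\<close>, and
  let \<open>R\<close> be the norm of the residual of \<open>u\<close>.  At a node where \<open>u - ubar\<close> is within \<open>x\<close> of \<open>m\<close> and is
  not negative, the gradient of \<open>u\<close> lies above that of \<open>ubar\<close> up to \<open>x / dx_min\<close>.  The Hamiltonian is
  monotone, grows at rate at least \<open>\<alpha>\<close> in each component of the gradient and at rate at most
  \<open>s_bar\<close> if all components grow together.  As its two values differ by at most \<open>R\<close>, no component
  of the gradient of \<open>u\<close> can be far above that of \<open>ubar\<close>.  Hence at each neighbour \<open>u - ubar\<close> is
  within \<open>A * R + (1 + B) * x\<close> of \<open>m\<close>, where \<open>A = dx_max / \<alpha>\<close> and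
  \<open>B = (s_bar / \<alpha>) * (dx_max / dx_min)\<close>; this is \<open>deficit_step\<close>.  A path of at most \<open>d_inf\<close> steps
  leads from a maximum point to the boundary, where \<open>u - ubar\<close> is at most \<open>R / lb\<close>.  Iterating along
  it bounds \<open>m\<close>; this is \<open>one_sided_stability\<close>.  Exchanging \<open>u\<close> and \<open>ubar\<close> gives the other sign.

  The analytic difficulty is that the rates \<open>\<alpha>\<close> and \<open>s_bar\<close> are known only through partial
  derivatives at almost every point, whereas the estimate needs increments between two given points,
  and the segment between them may lie in the exceptional null set.  Moreover the sum of the partial
  derivatives is a derivative along the diagonal only where the Hamiltonian is totally
  differentiable.  Both issues disappear on averaging over small cubes.  Translation invariance and
  dominated convergence show that the average is differentiable in every direction, with derivative
  the average of the corresponding combination of partial derivatives.  This yields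
  \<open>ae_mean_value_inequality\<close>, a mean value inequality for Lipschitz functions under almost everywhere
  bounds on partial derivatives, and from it \<open>hamiltonian_increment_le\<close>.
\<close>

section \<open>Measurability of Lipschitz functions and of their partial derivatives\<close>

text \<open>
  Only the coordinates in \<open>I\<close> matter for \<open>\<Psi>\<close>, so the other coordinates of \<open>a \<omega>\<close> can be reset to \<open>0\<close>.
  This turns the map into a measurable one followed by a continuous function on a second countable
  product space.
\<close>

lemma borel_measurable_lipschitz_coords:
  fixes \<Psi> :: "real \<Rightarrow> ('i::countable \<Rightarrow> real) \<Rightarrow> real"
  assumes lip: "\<And>s t p q. \<bar>\<Psi> s p - \<Psi> t q\<bar> \<le> K * \<bar>s - t\<bar> + L * (\<Sum>k\<in>I. \<bar>p k - q k\<bar>)"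
    and f: "f \<in> borel_measurable M"
    and a: "\<And>k. k \<in> I \<Longrightarrow> (\<lambda>\<omega>. a \<omega> k) \<in> borel_measurable M"
  shows "(\<lambda>\<omega>. \<Psi> (f \<omega>) (a \<omega>)) \<in> borel_measurable M"
proof -
  define F where "F x = \<Psi> (fst x) (snd x)" for x :: "real \<times> ('i \<Rightarrow> real)"
  have "continuous_on UNIV F"
    unfolding continuous_on_def
  proof
    fix x :: "real \<times> ('i \<Rightarrow> real)"
    have coord: "((\<lambda>y::real \<times> ('i \<Rightarrow> real). snd y k) \<longlongrightarrow> snd x k) (at x)" for k
      using continuous_on_tendsto_compose[OF continuous_on_product_coordinates[of k]
          tendsto_snd[OF tendsto_ident_at[of x UNIV]]] by simp
    have "((\<lambda>y. K * \<bar>fst y - fst x\<bar> + L * (\<Sum>k\<in>I. \<bar>snd y k - snd x k\<bar>)) \<longlongrightarrow>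
            K * \<bar>fst x - fst x\<bar> + L * (\<Sum>k\<in>I. \<bar>snd x k - snd x k\<bar>)) (at x)"
      by (intro tendsto_add tendsto_mult tendsto_const tendsto_rabs tendsto_diff tendsto_fst
          tendsto_ident_at tendsto_sum coord)
    then have "((\<lambda>y. K * \<bar>fst y - fst x\<bar> + L * (\<Sum>k\<in>I. \<bar>snd y k - snd x k\<bar>)) \<longlongrightarrow> 0) (at x)"
      by simp
    then have "((\<lambda>y. F y - F x) \<longlongrightarrow> 0) (at x)"
      by (rule Lim_null_comparison[rotated]) (simp add: F_def lip)
    then show "(F \<longlongrightarrow> F x) (at x within UNIV)"
      by (simp add: LIM_zero_iff)
  qed
  then have F: "F \<in> borel_measurable borel"
    by (rule borel_measurable_continuous_onI)
  define b where "b \<omega> = (\<lambda>k. if k \<in> I then a \<omega> k else 0)" for \<omega>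
  have "b \<in> borel_measurable M"
  proof (rule measurable_coordinatewise_then_product)
    show "(\<lambda>\<omega>. b \<omega> i) \<in> borel_measurable M" for i
      using a[of i] by (cases "i \<in> I") (simp_all add: b_def)
  qed
  with f have "(\<lambda>\<omega>. (f \<omega>, b \<omega>)) \<in> borel_measurable M"
    by (rule borel_measurable_Pair)
  then have "(\<lambda>\<omega>. F (f \<omega>, b \<omega>)) \<in> borel_measurable M"
    using F by (rule measurable_compose)
  moreover have "F (f \<omega>, b \<omega>) = \<Psi> (f \<omega>) (a \<omega>)" for \<omega>
    using lip[of "f \<omega>" "b \<omega>" "f \<omega>" "a \<omega>"] by (simp add: F_def b_def)
  ultimately show ?thesis
    by simp
qed

text \<open>
  For a difference quotient \<open>D\<close>, this is Cauchy's criterion for the existence of a limit at \<open>0\<close>.  The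
  increments range over the rationals only, so that the criterion is a countable combination of
  conditions on single values of \<open>D\<close> and hence a measurable condition on a parameter of \<open>D\<close>.
\<close>

definition rat_quotients_cauchy :: "(real \<Rightarrow> real) \<Rightarrow> bool" where
  "rat_quotients_cauchy D \<longleftrightarrow> (\<forall>n::nat. \<exists>m::nat. \<forall>h h'::rat. h \<noteq> 0 \<and> h' \<noteq> 0 \<and>
     \<bar>real_of_rat h\<bar> < 1 / Suc m \<and> \<bar>real_of_rat h'\<bar> < 1 / Suc m \<longrightarrow>
     \<bar>D (real_of_rat h) - D (real_of_rat h')\<bar> \<le> 1 / Suc n)"

lemma rat_quotients_cauchy_iff_convergent:
  fixes D :: "real \<Rightarrow> real"
  assumes cont: "\<And>h. h \<noteq> 0 \<Longrightarrow> isCont D h"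
  shows "rat_quotients_cauchy D \<longleftrightarrow> (\<exists>l. (D \<longlongrightarrow> l) (at 0))"
proof
  assume "\<exists>l. (D \<longlongrightarrow> l) (at 0)"
  then obtain l where l: "(D \<longlongrightarrow> l) (at 0)" ..
  show "rat_quotients_cauchy D"
    unfolding rat_quotients_cauchy_def
  proof
    fix n :: nat
    have "\<forall>\<^sub>F h in at 0. dist (D h) l < 1 / (2 * real (Suc n))"
      by (rule tendstoD[OF l]) simp
    then obtain d where d: "d > 0" "\<And>h. h \<noteq> 0 \<Longrightarrow> \<bar>h\<bar> < d \<Longrightarrow> \<bar>D h - l\<bar> < 1 / (2 * real (Suc n))"
      unfolding eventually_at by (auto simp: dist_real_def)
    obtain m :: nat where m: "1 / Suc m < d"
      using nat_approx_posE[OF d(1)] by auto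
    show "\<exists>m::nat. \<forall>h h'::rat. h \<noteq> 0 \<and> h' \<noteq> 0 \<and>
     \<bar>real_of_rat h\<bar> < 1 / Suc m \<and> \<bar>real_of_rat h'\<bar> < 1 / Suc m \<longrightarrow>
     \<bar>D (real_of_rat h) - D (real_of_rat h')\<bar> \<le> 1 / Suc n"
    proof (intro exI[of _ m] allI impI, elim conjE)
      fix h h' :: rat
      assume "h \<noteq> 0" "h' \<noteq> 0" "\<bar>real_of_rat h\<bar> < 1 / Suc m" "\<bar>real_of_rat h'\<bar> < 1 / Suc m"
      then have "\<bar>D (real_of_rat h) - l\<bar> < 1 / (2 * real (Suc n))" "\<bar>D (real_of_rat h') - l\<bar> < 1 / (2 * real (Suc n))"
        using d(2)[of "real_of_rat h"] d(2)[of "real_of_rat h'"] m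
        by (simp_all del: abs_of_rat of_nat_Suc of_nat_mult)
      then have "\<bar>D (real_of_rat h) - D (real_of_rat h')\<bar> \<le> 1 / (2 * real (Suc n)) + 1 / (2 * real (Suc n))"
        by (simp only: abs_less_iff abs_le_iff) linarith
      also have "\<dots> = 1 / Suc n"
        by (simp add: field_simps)
      finally show "\<bar>D (real_of_rat h) - D (real_of_rat h')\<bar> \<le> 1 / Suc n" .
    qed
  qed
next
  assume C: "rat_quotients_cauchy D"
  have close: "\<exists>m::nat. \<forall>h h'. h \<noteq> 0 \<and> h' \<noteq> 0 \<and> \<bar>h\<bar> < 1 / Suc m \<and> \<bar>h'\<bar> < 1 / Suc m \<longrightarrow>
      \<bar>D h - D h'\<bar> \<le> 1 / Suc n" for n
  proof -
    obtain m where m: "\<And>h h'::rat. h \<noteq> 0 \<Longrightarrow> h' \<noteq> 0 \<Longrightarrow> \<bar>real_of_rat h\<bar> < 1 / Suc m \<Longrightarrow>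
        \<bar>real_of_rat h'\<bar> < 1 / Suc m \<Longrightarrow> \<bar>D (real_of_rat h) - D (real_of_rat h')\<bar> \<le> 1 / Suc n"
      using C unfolding rat_quotients_cauchy_def by metis
    \<comment> \<open>Every nonzero real is a limit of nonzero rationals, at which \<open>D\<close> is continuous.\<close>
    have approx: "\<exists>x. (\<forall>i. x i \<noteq> 0 \<and> \<bar>real_of_rat (x i)\<bar> < 1 / Suc m) \<and> (\<lambda>i. D (real_of_rat (x i))) \<longlonglongrightarrow> D h"
      if h: "h \<noteq> 0" "\<bar>h\<bar> < 1 / Suc m" for h
    proof -
      define S where "S = {- (1 / real (Suc m)) <..< 1 / Suc m} - {0}"
      have "open S" "h \<in> S"
        using h by (auto simp: S_def intro!: open_Diff)
      then obtain e where e: "e > 0" "\<And>y. dist y h < e \<Longrightarrow> y \<in> S"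
        unfolding open_dist by blast
      have "\<exists>q::rat. h < real_of_rat q \<and> real_of_rat q < h + e / Suc i" for i
        using e(1) by (intro of_rat_dense) simp
      then obtain x where x: "\<And>i. h < real_of_rat (x i)" "\<And>i. real_of_rat (x i) < h + e / Suc i"
        by metis
      have "e / Suc i \<le> e" for i
        using e(1) by (simp add: field_simps)
      then have "dist (real_of_rat (x i)) h < e" for i
        using x(1,2)[of i] by (smt (verit) dist_real_def)
      then have "real_of_rat (x i) \<in> S" for i
        using e(2) by blast
      then have S: "x i \<noteq> 0 \<and> \<bar>real_of_rat (x i)\<bar> < 1 / Suc m" for i
        using that unfolding S_def abs_less_iff minus_less_iff[of "real_of_rat (x i)"] by force
      have "(\<lambda>i. h + e * (1 / Suc i)) \<longlonglongrightarrow> h + e * 0"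
        by (intro tendsto_intros LIMSEQ_Suc[OF lim_1_over_n])
      then have upper: "(\<lambda>i. h + e / Suc i) \<longlonglongrightarrow> h"
        by simp
      have "(\<lambda>i. real_of_rat (x i)) \<longlonglongrightarrow> h"
        by (rule real_tendsto_sandwich[OF _ _ tendsto_const upper])
           (use x in \<open>auto intro!: always_eventually less_imp_le\<close>)
      then have "(\<lambda>i. D (real_of_rat (x i))) \<longlonglongrightarrow> D h"
        by (rule isCont_tendsto_compose[OF cont[OF h(1)]])
      with S show ?thesis
        by blast
    qed
    show ?thesis
    proof (intro exI[of _ m] allI impI, elim conjE)
      fix h h' :: real
      assume "h \<noteq> 0" "\<bar>h\<bar> < 1 / Suc m" and "h' \<noteq> 0" "\<bar>h'\<bar> < 1 / Suc m"
      from approx[OF this(1,2)] approx[OF this(3,4)] obtain x y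
        where x: "\<And>i. x i \<noteq> 0 \<and> \<bar>real_of_rat (x i)\<bar> < 1 / Suc m" "(\<lambda>i. D (real_of_rat (x i))) \<longlonglongrightarrow> D h"
          and y: "\<And>i. y i \<noteq> 0 \<and> \<bar>real_of_rat (y i)\<bar> < 1 / Suc m" "(\<lambda>i. D (real_of_rat (y i))) \<longlonglongrightarrow> D h'"
        by metis
      have "(\<lambda>i. \<bar>D (real_of_rat (x i)) - D (real_of_rat (y i))\<bar>) \<longlonglongrightarrow> \<bar>D h - D h'\<bar>"
        by (intro tendsto_intros x y)
      then show "\<bar>D h - D h'\<bar> \<le> 1 / Suc n"
        by (rule LIMSEQ_le_const2) (use x y m in blast)
    qed
  qed
  show "\<exists>l. (D \<longlongrightarrow> l) (at 0)"
  proof -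
    have "Cauchy (\<lambda>i. D (1 / Suc i))"
    proof (rule metric_CauchyI)
      fix e :: real assume "e > 0"
      then obtain n :: nat where n: "1 / Suc n < e"
        using nat_approx_posE by blast
      obtain m where m: "\<And>h h'. h \<noteq> 0 \<Longrightarrow> h' \<noteq> 0 \<Longrightarrow> \<bar>h\<bar> < 1 / Suc m \<Longrightarrow> \<bar>h'\<bar> < 1 / Suc m \<Longrightarrow>
          \<bar>D h - D h'\<bar> \<le> 1 / Suc n"
        using close[of n] by metis
      have "dist (D (1 / Suc i)) (D (1 / Suc j)) < e" if "i > m" "j > m" for i j
        using m[of "1 / Suc i" "1 / Suc j"] that n by (simp add: dist_real_def frac_less2)
      then show "\<exists>M. \<forall>m\<ge>M. \<forall>n\<ge>M. dist (D (1 / Suc m)) (D (1 / Suc n)) < e"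
        by (intro exI[of _ "Suc m"]) auto
    qed
    then obtain l where l: "(\<lambda>i. D (1 / Suc i)) \<longlonglongrightarrow> l"
      using real_Cauchy_convergent convergent_def by blast
    have "(D \<longlongrightarrow> l) (at 0)"
    proof (rule tendstoI)
      fix e :: real assume "e > 0"
      then obtain n :: nat where n: "1 / Suc n < e"
        using nat_approx_posE by blast
      obtain m where m: "\<And>h h'. h \<noteq> 0 \<Longrightarrow> h' \<noteq> 0 \<Longrightarrow> \<bar>h\<bar> < 1 / Suc m \<Longrightarrow> \<bar>h'\<bar> < 1 / Suc m \<Longrightarrow>
          \<bar>D h - D h'\<bar> \<le> 1 / Suc n"
        using close[of n] by metis
      have "dist (D h) l < e" if h: "h \<noteq> 0" "\<bar>h\<bar> < 1 / Suc m" for h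
      proof -
        have "(\<lambda>i. \<bar>D h - D (1 / Suc i)\<bar>) \<longlonglongrightarrow> \<bar>D h - l\<bar>"
          by (intro tendsto_intros l)
        then have "\<bar>D h - l\<bar> \<le> 1 / Suc n"
        proof (rule LIMSEQ_le_const2)
          show "\<exists>N. \<forall>i\<ge>N. \<bar>D h - D (1 / Suc i)\<bar> \<le> 1 / Suc n"
            using m[of h] h by (intro exI[of _ "Suc m"]) (auto simp: frac_less2)
        qed
        with n show ?thesis
          by (simp add: dist_real_def)
      qed
      then show "\<forall>\<^sub>F h in at 0. dist (D h) l < e"
        unfolding eventually_at by (intro exI[of _ "1 / Suc m"]) (auto simp: dist_real_def)
    qed
    then show ?thesis ..
  qed
qed

text \<open>
  Where the derivative exists it is the limit of a sequence of difference quotients.  Everywhere else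
  \<open>deriv\<close> is one fixed constant, the value of the choice operator on the empty predicate.  The set
  that separates the two cases is measurable by the rational Cauchy criterion.
\<close>

lemma borel_measurable_deriv_at:
  fixes f :: "'a \<Rightarrow> real \<Rightarrow> real" and x0 :: "'a \<Rightarrow> real"
  assumes meas: "\<And>h. (\<lambda>\<omega>. f \<omega> (x0 \<omega> + h)) \<in> borel_measurable M"
    and cont: "\<And>\<omega>. continuous_on UNIV (f \<omega>)"
  shows "(\<lambda>\<omega>. deriv (f \<omega>) (x0 \<omega>)) \<in> borel_measurable M"
proof -
  define D where "D \<omega> h = (f \<omega> (x0 \<omega> + h) - f \<omega> (x0 \<omega>)) / h" for \<omega> h
  have D_meas [measurable]: "(\<lambda>\<omega>. D \<omega> h) \<in> borel_measurable M" for h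
    using meas[of h] meas[of 0] by (simp add: D_def)
  have cauchy_meas [measurable]: "Measurable.pred M (\<lambda>\<omega>. rat_quotients_cauchy (D \<omega>))"
    unfolding rat_quotients_cauchy_def by measurable
  have D_cont: "isCont (D \<omega>) h" if "h \<noteq> 0" for \<omega> h
  proof -
    have "isCont (f \<omega>) y" for y
      using cont[of \<omega>] by (simp add: continuous_on_eq_continuous_at)
    then have "isCont (\<lambda>h. f \<omega> (x0 \<omega> + h)) h"
      by (intro isCont_o2[of h "\<lambda>h. x0 \<omega> + h" "f \<omega>"] continuous_add continuous_const continuous_ident)
    with that show ?thesis
      unfolding D_def by (intro continuous_intros) auto
  qed
  have D_lim: "(D \<omega> \<longlongrightarrow> l) (at 0) \<longleftrightarrow> DERIV (f \<omega>) (x0 \<omega>) :> l" for \<omega> l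
    by (simp add: DERIV_def D_def[abs_def])
  define c where "c = (SOME D::real. False)"
  have "deriv (f \<omega>) (x0 \<omega>) = (if rat_quotients_cauchy (D \<omega>) then lim (\<lambda>i. D \<omega> (1 / Suc i)) else c)" for \<omega>
  proof (cases "rat_quotients_cauchy (D \<omega>)")
    case True
    then obtain l where l: "(D \<omega> \<longlongrightarrow> l) (at 0)"
      using rat_quotients_cauchy_iff_convergent[OF D_cont] by blast
    then have "deriv (f \<omega>) (x0 \<omega>) = l"
      by (simp add: D_lim DERIV_imp_deriv)
    moreover have "(\<lambda>i. D \<omega> (1 / Suc i)) \<longlonglongrightarrow> l"
      by (rule filterlim_compose[OF l])
         (auto simp: filterlim_at simp del: of_nat_Suc intro: LIMSEQ_Suc[OF lim_1_over_n])
    ultimately show ?thesis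
      using True by (simp add: limI)
  next
    case False
    then have "\<not> DERIV (f \<omega>) (x0 \<omega>) :> l" for l
      using rat_quotients_cauchy_iff_convergent[OF D_cont] D_lim by blast
    then show ?thesis
      using False by (simp add: deriv_def c_def)
  qed
  then have "(\<lambda>\<omega>. deriv (f \<omega>) (x0 \<omega>)) =
      (\<lambda>\<omega>. if rat_quotients_cauchy (D \<omega>) then lim (\<lambda>i. D \<omega> (1 / Suc i)) else c)"
    by (rule ext)
  also have "\<dots> \<in> borel_measurable M"
    by measurable
  finally show ?thesis .
qed

section \<open>Averaging over small cubes\<close>

abbreviation lebesgue_on_coords :: "'i set \<Rightarrow> ('i \<Rightarrow> real) measure" where
  "lebesgue_on_coords I \<equiv> \<Pi>\<^sub>M k\<in>I. lborel"

interpretation lborel_coords: product_sigma_finite "\<lambda>_::'i. lborel :: real measure"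
  by standard

text \<open>
  Translation invariance of Lebesgue measure, on boxes by the one-dimensional case.  The hypothesis
  that \<open>f\<close> depends only on the coordinates in \<open>I\<close> lets the translated point be written without
  restricting it to \<open>I\<close> again.
\<close>

lemma integral_coords_shift:
  fixes f :: "('i \<Rightarrow> real) \<Rightarrow> real"
  assumes fin: "finite I"
    and f: "f \<in> borel_measurable (lebesgue_on_coords I)"
    and coords: "\<And>p q. (\<And>k. k \<in> I \<Longrightarrow> p k = q k) \<Longrightarrow> f p = f q"
  shows "(\<integral>z. f (\<lambda>k. z k + w k) \<partial>lebesgue_on_coords I) = (\<integral>z. f z \<partial>lebesgue_on_coords I)"
proof -
  let ?M = "lebesgue_on_coords I"
  define T where "T z = (\<lambda>k\<in>I. z k + w k)" for z :: "'i \<Rightarrow> real"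
  have T [measurable]: "T \<in> measurable ?M ?M"
    unfolding T_def by measurable
  have "distr ?M ?M T = ?M"
  proof (rule lborel_coords.PiM_eqI[OF fin])
    fix A :: "'i \<Rightarrow> real set"
    assume A: "\<And>i. i \<in> I \<Longrightarrow> A i \<in> sets lborel"
    have vimage: "T -` Pi\<^sub>E I A \<inter> space ?M = (\<Pi>\<^sub>E k\<in>I. (\<lambda>x. w k + x) -` A k)"
      by (auto simp: T_def space_PiM PiE_iff add.commute)
    have "emeasure (distr ?M ?M T) (Pi\<^sub>E I A) = emeasure ?M (T -` Pi\<^sub>E I A \<inter> space ?M)"
      using A fin by (intro emeasure_distr T sets_PiM_I_finite) auto
    also have "\<dots> = (\<Prod>k\<in>I. emeasure lborel ((\<lambda>x. w k + x) -` A k))"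
      unfolding vimage using A fin
      by (intro lborel_coords.emeasure_PiM) (auto intro!: measurable_sets_borel[of "\<lambda>x. _ + x" borel])
    also have "\<dots> = (\<Prod>k\<in>I. emeasure lborel (A k))"
    proof (rule prod.cong[OF refl])
      fix k assume "k \<in> I"
      then have "emeasure (distr lborel borel (\<lambda>x. w k + x)) (A k) = emeasure lborel ((\<lambda>x. w k + x) -` A k)"
        using A by (subst emeasure_distr) auto
      then show "emeasure lborel ((\<lambda>x. w k + x) -` A k) = emeasure lborel (A k)"
        by (simp add: lborel_distr_plus)
    qed
    finally show "emeasure (distr ?M ?M T) (Pi\<^sub>E I A) = (\<Prod>k\<in>I. emeasure lborel (A k))" .
  qed simp
  then have "(\<integral>z. f z \<partial>?M) = (\<integral>z. f z \<partial>distr ?M ?M T)"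
    by simp
  also have "\<dots> = (\<integral>z. f (T z) \<partial>?M)"
    by (rule integral_distr[OF T f])
  also have "(\<lambda>z. f (T z)) = (\<lambda>z. f (\<lambda>k. z k + w k))"
    by (intro ext coords) (simp add: T_def)
  finally show ?thesis
    by simp
qed

definition cube :: "'i set \<Rightarrow> ('i \<Rightarrow> real) \<Rightarrow> real \<Rightarrow> ('i \<Rightarrow> real) set" where
  "cube I q r = (\<Pi>\<^sub>E k\<in>I. {q k - r .. q k + r})"

lemma cube_sets [measurable]: "finite I \<Longrightarrow> cube I q r \<in> sets (lebesgue_on_coords I)"
  unfolding cube_def by (intro sets_PiM_I_finite) auto

lemma emeasure_cube:
  assumes "finite I" "r \<ge> 0"
  shows "emeasure (lebesgue_on_coords I) (cube I q r) = ennreal (2 * r) ^ card I"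
proof -
  have "emeasure (lebesgue_on_coords I) (cube I q r) = (\<Prod>k\<in>I. emeasure lborel {q k - r .. q k + r})"
    unfolding cube_def using assms by (intro lborel_coords.emeasure_PiM) auto
  also have "\<dots> = (\<Prod>k\<in>I. ennreal (2 * r))"
    using assms by (intro prod.cong) (auto simp: emeasure_lborel_Icc_eq intro!: arg_cong[of _ _ ennreal])
  finally show ?thesis
    by simp
qed

lemma integrable_indicator_cube:
  assumes "finite I" "r \<ge> 0"
  shows "integrable (lebesgue_on_coords I) (\<lambda>z. C * indicator (cube I q r) z :: real)"
  using assms by (intro integrable_mult_right integrable_real_indicator cube_sets)
    (simp_all add: emeasure_cube ennreal_power)

text \<open>
  The integrands below carry a compactly supported weight, so they vanish off a cube.  Points of the
  product space are extensional, so outside the cube some coordinate in \<open>I\<close> is far from that of \<open>q\<close>.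
\<close>

lemma integrable_bounded_supported:
  fixes f :: "('i \<Rightarrow> real) \<Rightarrow> real"
  assumes "finite I" "r \<ge> 0"
    and f: "f \<in> borel_measurable (lebesgue_on_coords I)"
    and bound: "AE z in lebesgue_on_coords I. \<bar>f z\<bar> \<le> C"
    and supp: "\<And>z k. k \<in> I \<Longrightarrow> \<bar>z k - q k\<bar> > r \<Longrightarrow> f z = 0"
  shows "integrable (lebesgue_on_coords I) f"
proof (rule Bochner_Integration.integrable_bound)
  show "integrable (lebesgue_on_coords I) (\<lambda>z. C * indicator (cube I q r) z :: real)"
    by (rule integrable_indicator_cube) fact+
  show "AE z in lebesgue_on_coords I. norm (f z) \<le> norm (C * indicator (cube I q r) z :: real)"
    using bound AE_space
  proof eventually_elim
    case (elim z)
    show ?case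
    proof (cases "z \<in> cube I q r")
      case True
      then show ?thesis using elim by simp
    next
      case False
      then obtain k where "k \<in> I" "\<bar>z k - q k\<bar> > r"
        using elim(2) by (force simp: cube_def space_PiM PiE_iff abs_le_iff not_le)
      then show ?thesis using supp by simp
    qed
  qed
qed fact

text \<open>A product of tent functions: a continuous weight that lives on the cube of half-width \<open>e\<close>.\<close>

definition bump :: "'i set \<Rightarrow> real \<Rightarrow> ('i \<Rightarrow> real) \<Rightarrow> ('i \<Rightarrow> real) \<Rightarrow> real" where
  "bump I e q z = (\<Prod>k\<in>I. max 0 (1 - \<bar>z k - q k\<bar> / e))"

lemma bump_nonneg: "bump I e q z \<ge> 0"
  unfolding bump_def by (intro prod_nonneg) auto

lemma bump_le_1: "e > 0 \<Longrightarrow> bump I e q z \<le> 1"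
  unfolding bump_def by (intro prod_le_1) auto

lemma bump_eq_0: "finite I \<Longrightarrow> k \<in> I \<Longrightarrow> e > 0 \<Longrightarrow> \<bar>z k - q k\<bar> \<ge> e \<Longrightarrow> bump I e q z = 0"
  unfolding bump_def by (rule prod_zero) (auto intro!: bexI[of _ k] simp: field_simps)

lemma bump_measurable [measurable]: "bump I e q \<in> borel_measurable (lebesgue_on_coords I)"
  unfolding bump_def[abs_def] by measurable

lemma bump_shift: "bump I e (\<lambda>k. q k + w k) (\<lambda>k. z k + w k) = bump I e q z"
  by (simp add: bump_def)

lemma bump_cong: "(\<And>k. k \<in> I \<Longrightarrow> z k = z' k) \<Longrightarrow> bump I e q z = bump I e q z'"
  by (simp add: bump_def)

lemma integrable_bump: "finite I \<Longrightarrow> e > 0 \<Longrightarrow> integrable (lebesgue_on_coords I) (bump I e q)"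
  by (rule integrable_bounded_supported[where C = 1 and r = e and q = q])
     (auto simp: bump_nonneg bump_le_1 intro: bump_eq_0)

lemma integral_bump_shift:
  assumes "finite I"
  shows "(\<integral>z. bump I e (\<lambda>k. q k + w k) z \<partial>lebesgue_on_coords I) = (\<integral>z. bump I e q z \<partial>lebesgue_on_coords I)"
proof -
  let ?q = "\<lambda>k. q k + w k"
  have "(\<integral>z. bump I e ?q (\<lambda>k. z k + w k) \<partial>lebesgue_on_coords I) = (\<integral>z. bump I e ?q z \<partial>lebesgue_on_coords I)"
    by (rule integral_coords_shift[OF assms bump_measurable]) (rule bump_cong)
  then show ?thesis
    by (simp only: bump_shift)
qed

lemma integral_bump_pos:
  assumes "finite I" "e > 0"
  shows "(\<integral>z. bump I e q z \<partial>lebesgue_on_coords I) > 0"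
proof (rule ccontr)
  let ?M = "lebesgue_on_coords I"
  assume "\<not> ?thesis"
  moreover have "(\<integral>z. bump I e q z \<partial>?M) \<ge> 0"
    by (rule integral_nonneg_AE) (simp add: bump_nonneg)
  ultimately have "(\<integral>z. bump I e q z \<partial>?M) = 0"
    by simp
  then have "AE z in ?M. bump I e q z = 0"
    by (subst (asm) integral_nonneg_eq_0_iff_AE) (auto simp: bump_nonneg integrable_bump assms)
  then have "AE z in ?M. z \<notin> cube I q (e / 2)"
  proof eventually_elim
    case (elim z)
    show ?case
    proof
      assume z: "z \<in> cube I q (e / 2)"
      have "max 0 (1 - \<bar>z k - q k\<bar> / e) > 0" if "k \<in> I" for k
      proof -
        have "z k \<in> {q k - e / 2 .. q k + e / 2}"
          using z that by (auto simp: cube_def)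
        then have "\<bar>z k - q k\<bar> \<le> e / 2"
          by (simp only: atLeastAtMost_iff abs_le_iff) linarith
        with assms(2) show ?thesis
          by (simp add: less_max_iff_disj)
      qed
      then have "bump I e q z > 0"
        unfolding bump_def by (rule prod_pos)
      with elim show False by simp
    qed
  qed
  then have "emeasure ?M {z \<in> space ?M. z \<in> cube I q (e / 2)} = 0"
    by (rule emeasure_eq_0_AE)
  also have "{z \<in> space ?M. z \<in> cube I q (e / 2)} = cube I q (e / 2)"
    using sets.sets_into_space[OF cube_sets[OF assms(1), of q "e / 2"]] by auto
  finally show False
    using assms by (simp add: emeasure_cube)
qed

section \<open>A mean value inequality from almost everywhere partial derivatives\<close>

text \<open>
  A function on \<open>\<real>\<^bsup>I\<^esup>\<close>, encoded on the full function type so that points can be shifted and updated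
  without restricting them to \<open>I\<close>; the Lipschitz bound rules out a dependence on other coordinates.
\<close>

locale coord_lipschitz =
  fixes I :: "'i::countable set" and \<Phi> :: "('i \<Rightarrow> real) \<Rightarrow> real" and L :: real
  assumes fin: "finite I"
    and lip: "\<And>p q. \<bar>\<Phi> p - \<Phi> q\<bar> \<le> L * (\<Sum>k\<in>I. \<bar>p k - q k\<bar>)"
begin

abbreviation M :: "('i \<Rightarrow> real) measure" where
  "M \<equiv> lebesgue_on_coords I"

definition pderiv_coord :: "'i \<Rightarrow> ('i \<Rightarrow> real) \<Rightarrow> real" where
  "pderiv_coord k z = deriv (\<lambda>t. \<Phi> (z(k := t))) (z k)"

lemma coords_cong: "(\<And>k. k \<in> I \<Longrightarrow> p k = q k) \<Longrightarrow> \<Phi> p = \<Phi> q"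
  using lip[of p q] by simp

lemma lip_upd:
  assumes "k \<in> I"
  shows "\<bar>\<Phi> (z(k := s)) - \<Phi> (z(k := t))\<bar> \<le> L * \<bar>s - t\<bar>"
proof -
  have "(\<Sum>l\<in>I. \<bar>(z(k := s)) l - (z(k := t)) l\<bar>) = (\<Sum>l\<in>I. if l = k then \<bar>s - t\<bar> else 0)"
    by (intro sum.cong) auto
  also have "\<dots> = \<bar>s - t\<bar>"
    using assms fin by simp
  finally show ?thesis
    using lip[of "z(k := s)" "z(k := t)"] by simp
qed

lemma L_nonneg: "k \<in> I \<Longrightarrow> L \<ge> 0"
  using lip_upd[of k undefined 1 0] by simp

lemma continuous_upd:
  assumes "k \<in> I"
  shows "continuous_on UNIV (\<lambda>t. \<Phi> (z(k := t)))"
  by (rule lipschitz_on_continuous_on[of L])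
     (use assms in \<open>auto simp: lipschitz_on_def dist_real_def L_nonneg lip_upd\<close>)

lemma measurable_comp:
  assumes "\<And>k. k \<in> I \<Longrightarrow> (\<lambda>\<omega>. a \<omega> k) \<in> borel_measurable N"
  shows "(\<lambda>\<omega>. \<Phi> (a \<omega>)) \<in> borel_measurable N"
  by (rule borel_measurable_lipschitz_coords[where \<Psi> = "\<lambda>_. \<Phi>" and f = "\<lambda>_. 0" and K = 0, OF _ _ assms])
     (use lip in simp_all)

lemma measurable_coord [measurable]: "k \<in> I \<Longrightarrow> (\<lambda>z. z k) \<in> borel_measurable M"
  using measurable_component_singleton[of k I "\<lambda>_. lborel :: real measure"] by simp

lemma measurable_translate [measurable]: "(\<lambda>z. \<Phi> (\<lambda>k. z k + c k)) \<in> borel_measurable M"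
  by (rule measurable_comp) measurable

lemma measurable_\<Phi> [measurable]: "\<Phi> \<in> borel_measurable M"
  using measurable_translate[of "\<lambda>_. 0"] by simp

lemma measurable_upd:
  assumes "k \<in> I"
  shows "(\<lambda>z. \<Phi> (z(k := z k + h))) \<in> borel_measurable M"
  by (rule measurable_comp) (use assms in \<open>auto simp: measurable_coord\<close>)

lemma measurable_pderiv_coord [measurable]: "k \<in> I \<Longrightarrow> pderiv_coord k \<in> borel_measurable M"
  unfolding pderiv_coord_def[abs_def]
  by (rule borel_measurable_deriv_at) (auto intro: measurable_upd continuous_upd)

lemma quotient_tendsto_pderiv:
  assumes diff: "(\<lambda>t. \<Phi> (z(k := t))) differentiable (at (z k))"
    and h: "h \<longlonglongrightarrow> 0" "\<And>n. h n \<noteq> 0"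
  shows "(\<lambda>n. (\<Phi> (z(k := z k + h n * a)) - \<Phi> z) / h n) \<longlonglongrightarrow> a * pderiv_coord k z"
proof -
  let ?f = "\<lambda>t. \<Phi> (z(k := t))"
  have "DERIV ?f (z k) :> pderiv_coord k z"
    using diff unfolding pderiv_coord_def
    by (simp add: DERIV_deriv_iff_real_differentiable)
  then have "DERIV ?f (z k + 0 * a) :> pderiv_coord k z"
    by simp
  moreover have "DERIV (\<lambda>s. z k + s * a) 0 :> a"
    by (auto intro!: derivative_eq_intros)
  ultimately have "DERIV (\<lambda>s. ?f (z k + s * a)) 0 :> pderiv_coord k z * a"
    by (rule DERIV_chain2)
  then have lim: "((\<lambda>s. (?f (z k + s * a) - \<Phi> z) / s) \<longlongrightarrow> pderiv_coord k z * a) (at 0)"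
    by (simp add: DERIV_def)
  have "filterlim h (at 0) sequentially"
    using h by (simp add: filterlim_at)
  from filterlim_compose[OF lim this] show ?thesis
    by (simp add: mult.commute)
qed

lemma abs_pderiv_le:
  assumes "k \<in> I" "(\<lambda>t. \<Phi> (z(k := t))) differentiable (at (z k))"
  shows "\<bar>pderiv_coord k z\<bar> \<le> L"
proof -
  define h where "h n = 1 / real (Suc n)" for n
  have h: "h \<longlonglongrightarrow> 0" "h n > 0" for n
    unfolding h_def by (rule LIMSEQ_Suc[OF lim_1_over_n]) simp
  have "(\<lambda>n. (\<Phi> (z(k := z k + h n * 1)) - \<Phi> z) / h n) \<longlonglongrightarrow> 1 * pderiv_coord k z"
    by (rule quotient_tendsto_pderiv[OF assms(2) h(1)]) (use h(2) in \<open>simp add: less_imp_neq[symmetric]\<close>)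
  then have "(\<lambda>n. \<bar>(\<Phi> (z(k := z k + h n)) - \<Phi> z) / h n\<bar>) \<longlonglongrightarrow> \<bar>pderiv_coord k z\<bar>"
    by (intro tendsto_rabs) simp
  then show ?thesis
  proof (rule LIMSEQ_le_const2, intro exI allI impI)
    fix n
    show "\<bar>(\<Phi> (z(k := z k + h n)) - \<Phi> z) / h n\<bar> \<le> L"
      using lip_upd[OF assms(1), of z "z k + h n" "z k"] h(2)[of n]
      by (simp add: abs_divide divide_le_eq)
  qed
qed

lemma integrable_increment_bump:
  assumes "e > 0"
  shows "integrable M (\<lambda>z. (\<Phi> (\<lambda>k. z k + c k) - \<Phi> (\<lambda>k. z k + d k)) / h * bump I e q z)"
proof (rule integrable_bounded_supported[OF fin])
  show "(\<lambda>z. (\<Phi> (\<lambda>k. z k + c k) - \<Phi> (\<lambda>k. z k + d k)) / h * bump I e q z) \<in> borel_measurable M"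
    by measurable
  have "\<bar>(\<Phi> (\<lambda>k. z k + c k) - \<Phi> (\<lambda>k. z k + d k)) / h * bump I e q z\<bar>
      \<le> L * (\<Sum>k\<in>I. \<bar>c k - d k\<bar>) / \<bar>h\<bar> * 1" for z
    unfolding abs_mult abs_divide
    using lip[of "\<lambda>k. z k + c k" "\<lambda>k. z k + d k"] assms
    by (intro mult_mono divide_right_mono)
       (auto simp: bump_nonneg bump_le_1 intro!: divide_nonneg_nonneg elim: order_trans[rotated])
  then show "AE z in M. \<bar>(\<Phi> (\<lambda>k. z k + c k) - \<Phi> (\<lambda>k. z k + d k)) / h * bump I e q z\<bar>
      \<le> L * (\<Sum>k\<in>I. \<bar>c k - d k\<bar>) / \<bar>h\<bar> * 1"
    by simp
  show "(\<Phi> (\<lambda>k. z k + c k) - \<Phi> (\<lambda>k. z k + d k)) / h * bump I e q z = 0"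
    if "k \<in> I" "\<bar>z k - q k\<bar> > e" for z k
    using bump_eq_0[OF fin that(1) assms, of z q] that(2) by simp
qed (use assms in simp)

text \<open>
  Differentiation under the integral in one coordinate.  The weight is allowed to drift by \<open>w n\<close>, with
  limit \<open>0\<close>: this absorbs the translations that arise when increments in several coordinates are
  treated one after the other.
\<close>

lemma coord_quotient_integral_tendsto:
  assumes k: "k \<in> I" and e: "e > 0"
    and diff: "AE z in M. (\<lambda>t. \<Phi> (z(k := t))) differentiable (at (z k))"
    and h: "h \<longlonglongrightarrow> 0" "\<And>n. h n \<noteq> 0"
    and w: "\<And>l. l \<in> I \<Longrightarrow> (\<lambda>n. w n l) \<longlonglongrightarrow> 0" "\<And>n l. l \<in> I \<Longrightarrow> \<bar>w n l\<bar> \<le> B" "B \<ge> 0"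
  shows "(\<lambda>n. \<integral>z. (\<Phi> (z(k := z k + h n * a)) - \<Phi> z) / h n * bump I e (\<lambda>l. q l + w n l) z \<partial>M)
    \<longlonglongrightarrow> (\<integral>z. a * pderiv_coord k z * bump I e q z \<partial>M)"
proof (rule integral_dominated_convergence)
  show "(\<lambda>z. a * pderiv_coord k z * bump I e q z) \<in> borel_measurable M"
    using k by measurable
  show "(\<lambda>z. (\<Phi> (z(k := z k + h n * a)) - \<Phi> z) / h n * bump I e (\<lambda>l. q l + w n l) z) \<in> borel_measurable M" for n
    using measurable_upd[OF k] by measurable
  show "integrable M (\<lambda>z. L * \<bar>a\<bar> * indicator (cube I q (e + B)) z :: real)"
    using fin e w(3) by (intro integrable_indicator_cube) auto
  show "AE z in M. (\<lambda>n. (\<Phi> (z(k := z k + h n * a)) - \<Phi> z) / h n * bump I e (\<lambda>l. q l + w n l) z)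
      \<longlonglongrightarrow> a * pderiv_coord k z * bump I e q z"
    using diff
  proof eventually_elim
    case (elim z)
    have "(\<lambda>n. bump I e (\<lambda>l. q l + w n l) z) \<longlonglongrightarrow> (\<Prod>l\<in>I. max 0 (1 - \<bar>z l - (q l + 0)\<bar> / e))"
      unfolding bump_def using e by (intro tendsto_intros w) auto
    then have "(\<lambda>n. bump I e (\<lambda>l. q l + w n l) z) \<longlonglongrightarrow> bump I e q z"
      by (simp add: bump_def)
    with quotient_tendsto_pderiv[OF elim h] show ?case
      by (rule tendsto_mult)
  qed
  show "AE z in M. norm ((\<Phi> (z(k := z k + h n * a)) - \<Phi> z) / h n * bump I e (\<lambda>l. q l + w n l) z)
      \<le> L * \<bar>a\<bar> * indicator (cube I q (e + B)) z" for n
  proof (rule AE_I2)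
    fix z assume z: "z \<in> space M"
    show "norm ((\<Phi> (z(k := z k + h n * a)) - \<Phi> z) / h n * bump I e (\<lambda>l. q l + w n l) z)
      \<le> L * \<bar>a\<bar> * indicator (cube I q (e + B)) z"
    proof (cases "z \<in> cube I q (e + B)")
      case True
      have "\<bar>(\<Phi> (z(k := z k + h n * a)) - \<Phi> z) / h n\<bar> \<le> L * \<bar>a\<bar>"
        using lip_upd[OF k, of z "z k + h n * a" "z k"] h(2)[of n]
        by (simp add: abs_divide abs_mult divide_le_eq mult_ac)
      then have "\<bar>(\<Phi> (z(k := z k + h n * a)) - \<Phi> z) / h n\<bar> * \<bar>bump I e (\<lambda>l. q l + w n l) z\<bar> \<le> L * \<bar>a\<bar> * 1"
        using e L_nonneg[OF k] by (intro mult_mono) (auto simp: bump_nonneg bump_le_1)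
      with True show ?thesis
        by (simp add: abs_mult)
    next
      case False
      then obtain l where l: "l \<in> I" "\<not> (q l - (e + B) \<le> z l \<and> z l \<le> q l + (e + B))"
        using z by (auto simp: cube_def space_PiM PiE_iff)
      then have "\<bar>z l - (q l + w n l)\<bar> \<ge> e"
        using w(2)[OF l(1), of n] by linarith
      then have "bump I e (\<lambda>l. q l + w n l) z = 0"
        by (rule bump_eq_0[OF fin l(1) e])
      with False show ?thesis
        by simp
    qed
  qed
qed

text \<open>
  Pointwise, the derivative of \<open>\<Phi>\<close> in a direction \<open>v\<close> need not be the combination of its partial
  derivatives, not even where all of these exist.  After averaging it is: the increment is split into
  increments in single coordinates, and the increment in coordinate \<open>k\<close>, which starts at a displaced
  point, is moved back to \<open>z\<close> by a translation of the integration variable.  The displacement goes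
  into the weight, whose continuity makes it disappear in the limit.
\<close>

lemma direction_quotient_integral_tendsto:
  assumes J: "finite J" "J \<subseteq> I" and e: "e > 0"
    and diff: "\<And>k. k \<in> J \<Longrightarrow> AE z in M. (\<lambda>t. \<Phi> (z(k := t))) differentiable (at (z k))"
    and h: "h \<longlonglongrightarrow> 0" "\<And>n. h n \<noteq> 0"
  shows "(\<lambda>n. \<integral>z. (\<Phi> (\<lambda>l. z l + h n * (if l \<in> J then v l else 0)) - \<Phi> z) / h n * bump I e q z \<partial>M)
    \<longlonglongrightarrow> (\<Sum>k\<in>J. \<integral>z. v k * pderiv_coord k z * bump I e q z \<partial>M)"
  using J diff
proof (induction J)
  case empty
  then show ?case by simp
next
  case (insert k J)
  define w where "w n l = h n * (if l \<in> J then v l else 0)" for n l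
  obtain C where C: "\<And>n. \<bar>h n\<bar> \<le> C"
    using convergent_imp_Bseq[OF convergentI[OF h(1)]] by (auto simp: Bseq_def)
  have Cpos: "C \<ge> 0"
    using C[of 0] by linarith
  define B where "B = C * (\<Sum>l\<in>I. \<bar>v l\<bar>)"
  have w_le: "\<bar>w n l\<bar> \<le> B" if "l \<in> I" for n l
    unfolding w_def B_def abs_mult using C Cpos that fin
    by (intro mult_mono) (auto intro!: member_le_sum sum_nonneg)
  have w_lim: "(\<lambda>n. w n l) \<longlonglongrightarrow> 0" for l
    unfolding w_def using tendsto_mult_right[OF h(1), of "if l \<in> J then v l else 0"] by simp
  have step: "(\<lambda>n. \<integral>z. (\<Phi> (z(k := z k + h n * v k)) - \<Phi> z) / h n * bump I e (\<lambda>l. q l + w n l) z \<partial>M)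
    \<longlonglongrightarrow> (\<integral>z. v k * pderiv_coord k z * bump I e q z \<partial>M)"
  proof (rule coord_quotient_integral_tendsto[OF _ e _ h w_lim w_le])
    show "B \<ge> 0"
      using Cpos by (simp add: B_def sum_nonneg)
    show "k \<in> I"
      using insert.prems(1) by simp
    show "AE z in M. (\<lambda>t. \<Phi> (z(k := t))) differentiable (at (z k))"
      by (rule insert.prems(2)) simp
  qed
  have IH: "(\<lambda>n. \<integral>z. (\<Phi> (\<lambda>l. z l + w n l) - \<Phi> z) / h n * bump I e q z \<partial>M)
    \<longlonglongrightarrow> (\<Sum>k\<in>J. \<integral>z. v k * pderiv_coord k z * bump I e q z \<partial>M)"
    unfolding w_def using insert.IH insert.prems by simp
  define w' where "w' n l = h n * (if l \<in> insert k J then v l else 0)" for n l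
  have w': "w' n = (w n)(k := h n * v k)" and wk: "w n k = 0" for n
    using insert.hyps by (auto simp: w_def w'_def)
  have split: "(\<integral>z. (\<Phi> (\<lambda>l. z l + w' n l) - \<Phi> z) / h n * bump I e q z \<partial>M) =
      (\<integral>z. (\<Phi> (z(k := z k + h n * v k)) - \<Phi> z) / h n * bump I e (\<lambda>l. q l + w n l) z \<partial>M) +
      (\<integral>z. (\<Phi> (\<lambda>l. z l + w n l) - \<Phi> z) / h n * bump I e q z \<partial>M)" (is "?lhs = ?step + ?rest") for n
  proof -
    let ?f = "\<lambda>z. (\<Phi> (z(k := z k + h n * v k)) - \<Phi> z) / h n * bump I e (\<lambda>l. q l + w n l) z"
    have "?step = (\<integral>z. ?f (\<lambda>l. z l + w n l) \<partial>M)"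
    proof (rule integral_coords_shift[OF fin, symmetric])
      have [measurable]: "(\<lambda>z. \<Phi> (z(k := z k + h n * v k))) \<in> borel_measurable M"
        by (rule measurable_upd) (use insert.prems(1) in simp)
      show "?f \<in> borel_measurable M"
        by measurable
      show "?f y = ?f z" if "\<And>l. l \<in> I \<Longrightarrow> y l = z l" for y z
      proof -
        have "\<Phi> y = \<Phi> z" "\<Phi> (y(k := y k + h n * v k)) = \<Phi> (z(k := z k + h n * v k))"
          using that insert.prems by (auto intro!: coords_cong)
        moreover have "bump I e (\<lambda>l. q l + w n l) y = bump I e (\<lambda>l. q l + w n l) z"
          using that by (rule bump_cong)
        ultimately show ?thesis by simp
      qed
    qed
    also have "(\<lambda>z. ?f (\<lambda>l. z l + w n l)) =
        (\<lambda>z. (\<Phi> (\<lambda>l. z l + w' n l) - \<Phi> (\<lambda>l. z l + w n l)) / h n * bump I e q z)"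
    proof
      fix z
      have "(\<lambda>l. z l + w n l)(k := z k + w n k + h n * v k) = (\<lambda>l. z l + w' n l)"
        by (auto simp: w' wk)
      then show "?f (\<lambda>l. z l + w n l) = (\<Phi> (\<lambda>l. z l + w' n l) - \<Phi> (\<lambda>l. z l + w n l)) / h n * bump I e q z"
        by (simp only: bump_shift)
    qed
    finally have "?step + ?rest =
        (\<integral>z. (\<Phi> (\<lambda>l. z l + w' n l) - \<Phi> (\<lambda>l. z l + w n l)) / h n * bump I e q z \<partial>M) + ?rest"
      by (simp only:)
    also have "\<dots> = (\<integral>z. (\<Phi> (\<lambda>l. z l + w' n l) - \<Phi> (\<lambda>l. z l + w n l)) / h n * bump I e q z
        + (\<Phi> (\<lambda>l. z l + w n l) - \<Phi> z) / h n * bump I e q z \<partial>M)"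
      using integrable_increment_bump[OF e, of "w' n" "w n"]
        integrable_increment_bump[OF e, of "w n" "\<lambda>_. 0"]
      by (intro Bochner_Integration.integral_add[symmetric]) simp_all
    also have "\<dots> = ?lhs"
      by (intro Bochner_Integration.integral_cong) (auto simp: field_simps diff_divide_distrib)
    finally show ?thesis ..
  qed
  have "(\<lambda>n. \<integral>z. (\<Phi> (\<lambda>l. z l + w' n l) - \<Phi> z) / h n * bump I e q z \<partial>M) \<longlonglongrightarrow>
    (\<integral>z. v k * pderiv_coord k z * bump I e q z \<partial>M) +
    (\<Sum>k\<in>J. \<integral>z. v k * pderiv_coord k z * bump I e q z \<partial>M)"
    unfolding split by (rule tendsto_add[OF step IH])
  then show ?case
    using insert.hyps by (simp add: w'_def)
qed

lemma integrable_pderiv_bump: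
  assumes "k \<in> I" "e > 0"
    and diff: "AE z in M. (\<lambda>t. \<Phi> (z(k := t))) differentiable (at (z k))"
  shows "integrable M (\<lambda>z. a * pderiv_coord k z * bump I e q z)"
proof (rule integrable_bounded_supported[OF fin])
  show "(\<lambda>z. a * pderiv_coord k z * bump I e q z) \<in> borel_measurable M"
    using assms(1) by measurable
  show "AE z in M. \<bar>a * pderiv_coord k z * bump I e q z\<bar> \<le> \<bar>a\<bar> * L * 1"
    using diff
  proof eventually_elim
    case (elim z)
    show ?case
      unfolding abs_mult using abs_pderiv_le[OF assms(1) elim] L_nonneg[OF assms(1)] assms(2)
      by (intro mult_mono) (auto simp: bump_nonneg bump_le_1)
  qed
  show "a * pderiv_coord k z * bump I e q z = 0" if "l \<in> I" "\<bar>z l - q l\<bar> > e" for z l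
    using bump_eq_0[OF fin that(1) assms(2), of z q] that(2) by simp
qed (use assms in simp)

text \<open>
  The average \<open>G t\<close> of \<open>\<Phi> (z + t v) - \<Phi> z\<close> over a small cube around \<open>q\<close> is differentiable in \<open>t\<close>, and
  its derivative is an average of \<open>\<Sum>k. v k * \<partial>\<^sub>k \<Phi>\<close>, to which the almost everywhere bound applies.
  Integration over \<open>0 \<le> t \<le> 1\<close> gives the claim up to an error of the order of the size of the cube.
\<close>

theorem ae_mean_value_inequality:
  assumes diff: "\<And>k. k \<in> I \<Longrightarrow> AE z in M. (\<lambda>t. \<Phi> (z(k := t))) differentiable (at (z k))"
    and bound: "AE z in M. (\<Sum>k\<in>I. v k * pderiv_coord k z) \<le> c"
  shows "\<Phi> (\<lambda>k. q k + v k) - \<Phi> q \<le> c"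
proof -
  have approx: "\<Phi> (\<lambda>k. q k + v k) - \<Phi> q - 2 * (\<bar>L\<bar> * (card I * e)) \<le> c" if e: "e > 0" for e :: real
  proof -
    define K where "K = (\<integral>z. bump I e q z \<partial>M)"
    have K: "K > 0"
      unfolding K_def by (rule integral_bump_pos[OF fin e])
    define S where "S p = (\<Sum>k\<in>I. \<integral>z. v k * pderiv_coord k z * bump I e p z \<partial>M)" for p
    have S_le: "S (\<lambda>k. q k + t * v k) \<le> c * K" for t
    proof -
      let ?p = "\<lambda>k. q k + t * v k"
      have "S ?p = (\<integral>z. (\<Sum>k\<in>I. v k * pderiv_coord k z * bump I e ?p z) \<partial>M)"
        unfolding S_def
        by (intro Bochner_Integration.integral_sum[symmetric] integrable_pderiv_bump e diff)
      also have "\<dots> \<le> (\<integral>z. c * bump I e ?p z \<partial>M)"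
      proof (rule integral_mono_AE)
        show "integrable M (\<lambda>z. \<Sum>k\<in>I. v k * pderiv_coord k z * bump I e ?p z)"
          by (intro Bochner_Integration.integrable_sum integrable_pderiv_bump e diff)
        show "integrable M (\<lambda>z. c * bump I e ?p z)"
          by (intro integrable_mult_right integrable_bump fin e)
        show "AE z in M. (\<Sum>k\<in>I. v k * pderiv_coord k z * bump I e ?p z) \<le> c * bump I e ?p z"
          using bound
          by eventually_elim (simp add: bump_nonneg mult_right_mono flip: sum_distrib_right)
      qed
      also have "\<dots> = c * K"
        using integral_bump_shift[OF fin, of e q "\<lambda>k. t * v k"] by (simp add: K_def)
      finally show ?thesis .
    qed
    define G where "G t = (\<integral>z. (\<Phi> (\<lambda>k. z k + t * v k) - \<Phi> z) * bump I e q z \<partial>M)" for t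
    have G_int: "integrable M (\<lambda>z. (\<Phi> (\<lambda>k. z k + t * v k) - \<Phi> z) * bump I e q z)" for t
      using integrable_increment_bump[OF e, of "\<lambda>k. t * v k" "\<lambda>_. 0" 1] by simp
    have G_deriv: "DERIV G t :> S (\<lambda>k. q k + t * v k)" for t
      unfolding DERIV_def tendsto_at_iff_sequentially comp_def
    proof (intro allI impI)
      fix h :: "nat \<Rightarrow> real"
      assume "\<forall>n. h n \<in> UNIV - {0}" and h: "h \<longlonglongrightarrow> 0"
      then have h0: "h n \<noteq> 0" for n by auto
      let ?p = "\<lambda>k. q k + t * v k"
      let ?f = "\<lambda>n z. (\<Phi> (\<lambda>k. z k + h n * (if k \<in> I then v k else 0)) - \<Phi> z) / h n * bump I e ?p z"
      \<comment> \<open>Translation by \<open>t * v\<close> moves the base point back to \<open>z\<close> and the centre of the weight to \<open>?p\<close>.\<close>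
      have quot: "(G (t + h n) - G t) / h n = (\<integral>z. ?f n z \<partial>M)" for n
      proof -
        have "(G (t + h n) - G t) / h n =
          (\<integral>z. ((\<Phi> (\<lambda>k. z k + (t + h n) * v k) - \<Phi> z) * bump I e q z
            - (\<Phi> (\<lambda>k. z k + t * v k) - \<Phi> z) * bump I e q z) / h n \<partial>M)"
          unfolding G_def using G_int by simp
        also have "\<dots> = (\<integral>z. ?f n (\<lambda>k. z k + t * v k) \<partial>M)"
        proof (rule Bochner_Integration.integral_cong[OF refl])
          fix z
          have "\<Phi> (\<lambda>k. z k + t * v k + h n * (if k \<in> I then v k else 0)) = \<Phi> (\<lambda>k. z k + (t + h n) * v k)"
            by (rule coords_cong) (simp add: algebra_simps)
          then show "((\<Phi> (\<lambda>k. z k + (t + h n) * v k) - \<Phi> z) * bump I e q z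
            - (\<Phi> (\<lambda>k. z k + t * v k) - \<Phi> z) * bump I e q z) / h n = ?f n (\<lambda>k. z k + t * v k)"
            by (simp only: bump_shift) (simp add: algebra_simps)
        qed
        also have "\<dots> = (\<integral>z. ?f n z \<partial>M)"
        proof (rule integral_coords_shift[OF fin])
          show "?f n \<in> borel_measurable M"
            by measurable
          show "?f n y = ?f n z" if "\<And>l. l \<in> I \<Longrightarrow> y l = z l" for y z
          proof -
            have "\<Phi> y = \<Phi> z" "\<Phi> (\<lambda>k. y k + h n * (if k \<in> I then v k else 0)) =
                \<Phi> (\<lambda>k. z k + h n * (if k \<in> I then v k else 0))"
              using that by (auto intro!: coords_cong)
            moreover have "bump I e ?p y = bump I e ?p z"
              using that by (rule bump_cong)
            ultimately show ?thesis by simp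
          qed
        qed
        finally show ?thesis .
      qed
      show "(\<lambda>n. (G (t + h n) - G t) / h n) \<longlonglongrightarrow> S ?p"
        unfolding S_def quot
        by (rule direction_quotient_integral_tendsto[OF fin subset_refl e diff h h0])
    qed
    have "G 0 - 0 * (c * K) \<ge> G 1 - 1 * (c * K)"
    proof (rule DERIV_nonpos_imp_nonincreasing[where f = "\<lambda>t. G t - t * (c * K)"])
      fix t :: real
      have "DERIV (\<lambda>t. G t - t * (c * K)) t :> S (\<lambda>k. q k + t * v k) - 1 * (c * K)"
        by (intro DERIV_diff G_deriv DERIV_cmult_right DERIV_ident)
      then show "\<exists>y. DERIV (\<lambda>t. G t - t * (c * K)) t :> y \<and> y \<le> 0"
        using S_le[of t] by (intro exI[of _ "S (\<lambda>k. q k + t * v k) - 1 * (c * K)"]) simp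
    qed simp
    then have "G 1 \<le> c * K"
      by (simp add: G_def)
    moreover have "(\<Phi> (\<lambda>k. q k + v k) - \<Phi> q - 2 * (\<bar>L\<bar> * (card I * e))) * K \<le> G 1"
    proof -
      let ?D = "\<Phi> (\<lambda>k. q k + v k) - \<Phi> q - 2 * (\<bar>L\<bar> * (card I * e))"
      have "?D * K = (\<integral>z. ?D * bump I e q z \<partial>M)"
        by (simp add: K_def)
      also have "\<dots> \<le> (\<integral>z. (\<Phi> (\<lambda>k. z k + 1 * v k) - \<Phi> z) * bump I e q z \<partial>M)"
      proof (rule integral_mono)
        show "integrable M (\<lambda>z. ?D * bump I e q z)"
          by (intro integrable_mult_right integrable_bump fin e)
        fix z
        show "?D * bump I e q z \<le> (\<Phi> (\<lambda>k. z k + 1 * v k) - \<Phi> z) * bump I e q z"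
        proof (cases "\<exists>k\<in>I. \<bar>z k - q k\<bar> \<ge> e")
          case True
          then show ?thesis
            using bump_eq_0[OF fin _ e] by auto
        next
          case False
          have "L * (\<Sum>k\<in>I. \<bar>z k - q k\<bar>) \<le> \<bar>L\<bar> * (\<Sum>k\<in>I. e)"
            using False e by (intro mult_mono sum_mono) (auto intro: sum_nonneg less_imp_le)
          then have "L * (\<Sum>k\<in>I. \<bar>z k - q k\<bar>) \<le> \<bar>L\<bar> * (card I * e)"
            by simp
          moreover have "\<bar>\<Phi> (\<lambda>k. z k + v k) - \<Phi> (\<lambda>k. q k + v k)\<bar> \<le> L * (\<Sum>k\<in>I. \<bar>z k - q k\<bar>)"
            using lip[of "\<lambda>k. z k + v k" "\<lambda>k. q k + v k"] by simp
          moreover have "\<bar>\<Phi> z - \<Phi> q\<bar> \<le> L * (\<Sum>k\<in>I. \<bar>z k - q k\<bar>)"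
            by (rule lip)
          ultimately have "?D \<le> \<Phi> (\<lambda>k. z k + 1 * v k) - \<Phi> z"
            unfolding mult_1 by linarith
          then show ?thesis
            by (rule mult_right_mono) (rule bump_nonneg)
        qed
      qed (rule G_int)
      finally show ?thesis
        by (simp add: G_def)
    qed
    ultimately have "(\<Phi> (\<lambda>k. q k + v k) - \<Phi> q - 2 * (\<bar>L\<bar> * (card I * e))) * K \<le> c * K"
      by linarith
    with K show ?thesis
      by simp
  qed
  show ?thesis
  proof (rule field_le_epsilon)
    fix \<epsilon> :: real
    assume "\<epsilon> > 0"
    define e where "e = \<epsilon> / (2 * (\<bar>L\<bar> * card I) + 1)"
    have pos: "2 * (\<bar>L\<bar> * card I) + 1 > 0"
      by (intro add_nonneg_pos) auto
    then have e: "e > 0"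
      using \<open>\<epsilon> > 0\<close> by (simp add: e_def)
    have "(2 * (\<bar>L\<bar> * card I) + 1) * e = \<epsilon>"
      using pos by (simp add: e_def)
    then have "2 * (\<bar>L\<bar> * (card I * e)) + e = \<epsilon>"
      by (simp add: algebra_simps)
    with approx[OF e] e show "\<Phi> (\<lambda>k. q k + v k) - \<Phi> q \<le> c + \<epsilon>"
      by linarith
  qed
qed

end

section \<open>Increments of the Hamiltonian\<close>

lemma H1_coord_lipschitz:
  fixes N :: "'v::finite \<Rightarrow> 'v set"
  assumes "H1 N H"
  obtains Lu Lp where
    "\<And>j s t p q. j \<in> inner_nodes N \<Longrightarrow>
       \<bar>H j s (restrict p (N j)) - H j t (restrict q (N j))\<bar> \<le> Lu * \<bar>s - t\<bar> + Lp * (\<Sum>k\<in>N j. \<bar>p k - q k\<bar>)"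
proof -
  from assms obtain Lu Lp where Lp: "Lp > 0"
    and u: "\<forall>j\<in>inner_nodes N. \<forall>s t. \<forall>p\<in>N j \<rightarrow>\<^sub>E UNIV. \<bar>H j s p - H j t p\<bar> \<le> Lu * \<bar>s - t\<bar>"
    and p: "\<forall>j\<in>inner_nodes N. \<forall>s. \<forall>p\<in>N j \<rightarrow>\<^sub>E UNIV. \<forall>q\<in>N j \<rightarrow>\<^sub>E UNIV.
        \<bar>H j s p - H j s q\<bar> \<le> Lp * (MAX k\<in>N j. \<bar>p k - q k\<bar>)"
    unfolding H1_def by (elim exE conjE)
  show thesis
  proof (rule that)
    fix j s t and p q :: "'v \<Rightarrow> real"
    assume j: "j \<in> inner_nodes N"
    let ?p = "restrict p (N j)" and ?q = "restrict q (N j)"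
    have "\<bar>?p k - ?q k\<bar> \<le> (\<Sum>k\<in>N j. \<bar>p k - q k\<bar>)" if "k \<in> N j" for k
      using member_le_sum[of k "N j" "\<lambda>k. \<bar>p k - q k\<bar>"] that by simp
    then have "(MAX k\<in>N j. \<bar>?p k - ?q k\<bar>) \<le> (\<Sum>k\<in>N j. \<bar>p k - q k\<bar>)"
      using j by (subst Max_le_iff) (auto simp: inner_nodes_def)
    then have "Lp * (MAX k\<in>N j. \<bar>?p k - ?q k\<bar>) \<le> Lp * (\<Sum>k\<in>N j. \<bar>p k - q k\<bar>)"
      using Lp by (intro mult_left_mono) auto
    moreover have "\<bar>H j t ?p - H j t ?q\<bar> \<le> Lp * (MAX k\<in>N j. \<bar>?p k - ?q k\<bar>)"
      by (rule p[rule_format, OF j]) auto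
    moreover have "\<bar>H j s ?p - H j t ?p\<bar> \<le> Lu * \<bar>s - t\<bar>"
      by (rule u[rule_format, OF j]) auto
    ultimately show "\<bar>H j s ?p - H j t ?q\<bar> \<le> Lu * \<bar>s - t\<bar> + Lp * (\<Sum>k\<in>N j. \<bar>p k - q k\<bar>)"
      by linarith
  qed
qed

lemma coord_lipschitz_slice:
  fixes \<Psi> :: "real \<Rightarrow> ('i::countable \<Rightarrow> real) \<Rightarrow> real"
  assumes "finite I" and lip: "\<And>s t p q. \<bar>\<Psi> s p - \<Psi> t q\<bar> \<le> K * \<bar>s - t\<bar> + L * (\<Sum>k\<in>I. \<bar>p k - q k\<bar>)"
  shows "coord_lipschitz I (\<Psi> u) L"
proof
  show "\<bar>\<Psi> u p - \<Psi> u q\<bar> \<le> L * (\<Sum>k\<in>I. \<bar>p k - q k\<bar>)" for p q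
    using lip[of u p u q] by simp
qed fact

lemma restrict_upd_PiE:
  assumes "p \<in> A \<rightarrow>\<^sub>E UNIV" "k \<in> A"
  shows "restrict (p(k := t)) A = p(k := t)"
  using assms by (intro extensional_restrict) (auto simp: PiE_iff extensional_def)

text \<open>
  The essential supremum bounds its function almost everywhere.  For \<open>s_bar\<close> to inherit this, the
  supremum must not be infinite before it is converted to a real number.  That needs measurability,
  as \<open>esssup\<close> of a non-measurable function is \<open>top\<close>, and an upper bound for the partial derivatives
  at every point, including those where \<open>deriv\<close> takes its default value.
\<close>

lemma AE_sum_partial_le_s_bar:
  fixes N :: "'v::finite \<Rightarrow> 'v set"
  assumes "H1 N H" and j: "j \<in> inner_nodes N"
  shows "AE (u, p) in lborel \<Otimes>\<^sub>M lebesgue_on_coords (N j). (\<Sum>k\<in>N j. partial_p H j u p k) \<le> s_bar N H"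
proof -
  obtain Lu Lp where lip: "\<And>j s t p q. j \<in> inner_nodes N \<Longrightarrow>
       \<bar>H j s (restrict p (N j)) - H j t (restrict q (N j))\<bar> \<le> Lu * \<bar>s - t\<bar> + Lp * (\<Sum>k\<in>N j. \<bar>p k - q k\<bar>)"
    using H1_coord_lipschitz[OF assms(1)] by blast
  have cl: "coord_lipschitz (N i) (\<lambda>p. H i u (restrict p (N i))) Lp" if "i \<in> inner_nodes N" for i u
    by (rule coord_lipschitz_slice[where \<Psi> = "\<lambda>u p. H i u (restrict p (N i))", OF finite lip[OF that]])
  let ?M = "\<lambda>i. (lborel :: real measure) \<Otimes>\<^sub>M lebesgue_on_coords (N i)"
  let ?F = "\<lambda>i (u, p). ereal (\<Sum>k\<in>N i. partial_p H i u p k)"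
  have partial: "partial_p H i u p k = deriv (\<lambda>t. H i u (restrict (p(k := t)) (N i))) (p k)"
    if "p \<in> N i \<rightarrow>\<^sub>E UNIV" "k \<in> N i" for i u p k
    unfolding partial_p_def by (simp only: restrict_upd_PiE[OF that])
  have meas: "?F i \<in> borel_measurable (?M i)" if i: "i \<in> inner_nodes N" for i
  proof -
    have coord: "(\<lambda>x. snd x k) \<in> borel_measurable (?M i)" if "k \<in> N i" for k
      using measurable_compose[OF measurable_snd[of lborel "lebesgue_on_coords (N i)"]
          measurable_component_singleton[OF that, of "\<lambda>_. lborel :: real measure"]] by simp
    have "(\<lambda>x. deriv (\<lambda>t. H i (fst x) (restrict ((snd x)(k := t)) (N i))) (snd x k)) \<in> borel_measurable (?M i)"
      if k: "k \<in> N i" for k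
    proof (rule borel_measurable_deriv_at)
      show "continuous_on UNIV (\<lambda>t. H i (fst x) (restrict ((snd x)(k := t)) (N i)))" for x
        by (rule coord_lipschitz.continuous_upd[OF cl[OF i] k])
      show "(\<lambda>x. H i (fst x) (restrict ((snd x)(k := snd x k + h)) (N i))) \<in> borel_measurable (?M i)" for h
      proof (rule borel_measurable_lipschitz_coords[where \<Psi> = "\<lambda>u p. H i u (restrict p (N i))", OF lip[OF i]])
        show "fst \<in> borel_measurable (?M i)"
          using measurable_fst[of lborel "lebesgue_on_coords (N i)"] by simp
        show "(\<lambda>x. ((snd x)(k := snd x k + h)) l) \<in> borel_measurable (?M i)" if "l \<in> N i" for l
          using coord[OF k] coord[OF that] by (cases "l = k") auto
      qed
    qed
    then have "(\<lambda>x. ereal (\<Sum>k\<in>N i. deriv (\<lambda>t. H i (fst x) (restrict ((snd x)(k := t)) (N i))) (snd x k)))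
        \<in> borel_measurable (?M i)"
      by (intro borel_measurable_ereal borel_measurable_sum)
    also have "?this \<longleftrightarrow> ?F i \<in> borel_measurable (?M i)"
      by (intro measurable_cong) (auto simp: space_pair_measure space_PiM partial)
    finally show ?thesis .
  qed
  \<comment> \<open>The value of \<open>deriv\<close> at points of non-differentiability.\<close>
  define c where "c = (SOME D::real. False)"
  define C where "C = max \<bar>Lp\<bar> \<bar>c\<bar>"
  have partial_le: "partial_p H i u p k \<le> C"
    if i: "i \<in> inner_nodes N" and p: "p \<in> N i \<rightarrow>\<^sub>E UNIV" and k: "k \<in> N i" for i u p k
  proof (cases "(\<lambda>t. H i u (restrict (p(k := t)) (N i))) differentiable (at (p k))")
    case True
    from coord_lipschitz.abs_pderiv_le[OF cl[OF i] k this] have "\<bar>partial_p H i u p k\<bar> \<le> Lp"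
      by (simp only: coord_lipschitz.pderiv_coord_def[OF cl[OF i]] partial[OF p k])
    then show ?thesis
      by (simp add: C_def)
  next
    case False
    then have "\<not> DERIV (\<lambda>t. H i u (restrict (p(k := t)) (N i))) (p k) :> D" for D
      by (simp add: real_differentiable_def)
    then have "partial_p H i u p k = c"
      by (simp add: partial[OF p k] deriv_def c_def)
    then show ?thesis
      by (simp add: C_def)
  qed
  define S where "S = (SUP i\<in>inner_nodes N. esssup (?M i) (?F i))"
  have "S \<le> ereal (real CARD('v) * C)"
    unfolding S_def
  proof (rule SUP_least)
    fix i assume i: "i \<in> inner_nodes N"
    have "(\<Sum>k\<in>N i. partial_p H i u p k) \<le> real CARD('v) * C" if "p \<in> N i \<rightarrow>\<^sub>E UNIV" for u p
    proof -
      have "(\<Sum>k\<in>N i. partial_p H i u p k) \<le> (\<Sum>k\<in>N i. C)"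
        by (intro sum_mono partial_le i that)
      also have "\<dots> \<le> (\<Sum>k\<in>(UNIV::'v set). C)"
        by (intro sum_mono2) (auto simp: C_def)
      finally show ?thesis by simp
    qed
    then have "AE x in ?M i. ?F i x \<le> ereal (real CARD('v) * C)"
      by (intro AE_I2) (auto simp: space_pair_measure space_PiM)
    with meas[OF i] show "esssup (?M i) (?F i) \<le> ereal (real CARD('v) * C)"
      by (rule esssup_I)
  qed
  then have "S \<le> ereal (real_of_ereal S)"
    by (cases S) auto
  moreover have "esssup (?M j) (?F j) \<le> S"
    unfolding S_def using j by (rule SUP_upper)
  moreover have "real_of_ereal S = s_bar N H"
    by (simp add: S_def s_bar_def)
  ultimately have "esssup (?M j) (?F j) \<le> ereal (s_bar N H)"
    by simp
  then have "?F j x \<le> ereal (s_bar N H)" if "?F j x \<le> esssup (?M j) (?F j)" for x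
    by (rule order_trans[OF that])
  with esssup_AE[of "?F j" "?M j"] have "AE x in ?M j. ?F j x \<le> ereal (s_bar N H)"
    by (rule eventually_mono)
  then show ?thesis
    by (simp add: case_prod_beta)
qed

text \<open>
  With \<open>d l\<close> for the partial derivatives, the slope in direction \<open>q - p\<close> is
  \<open>\<delta> * (\<Sum>l. d l) - (\<Sum>l. (\<delta> - (q l - p l)) * d l)\<close>.  The first sum is at most \<open>s_bar N H\<close>; the terms
  of the second are nonnegative, and the one for \<open>k\<close> is at least \<open>\<alpha> * (\<delta> - (q k - p k))\<close>.  Since
  \<open>s_bar\<close> controls only almost every \<open>u\<close>, the estimate is obtained for these first and reaches the
  others by continuity in \<open>u\<close>.
\<close>

lemma hamiltonian_increment_le:
  fixes N :: "'v::finite \<Rightarrow> 'v set"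
  assumes H1: "H1 N H" and H4i: "H4i N H \<alpha>" and \<alpha>: "\<alpha> \<ge> 0"
    and j: "j \<in> inner_nodes N" and k: "k \<in> N j"
    and p: "p \<in> N j \<rightarrow>\<^sub>E UNIV" and q: "q \<in> N j \<rightarrow>\<^sub>E UNIV"
    and \<delta>: "\<delta> \<ge> 0" "\<And>l. l \<in> N j \<Longrightarrow> q l - p l \<le> \<delta>"
  shows "H j u q - H j u p \<le> s_bar N H * \<delta> - \<alpha> * (\<delta> - (q k - p k))"
proof -
  obtain Lu Lp where lip: "\<And>j s t p q. j \<in> inner_nodes N \<Longrightarrow>
       \<bar>H j s (restrict p (N j)) - H j t (restrict q (N j))\<bar> \<le> Lu * \<bar>s - t\<bar> + Lp * (\<Sum>k\<in>N j. \<bar>p k - q k\<bar>)"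
    using H1_coord_lipschitz[OF H1] by blast
  let ?M = "lebesgue_on_coords (N j)"
  interpret M: sigma_finite_measure ?M
    by (rule lborel_coords.sigma_finite) simp
  interpret pair_sigma_finite lborel ?M
    by unfold_locales
  define c where "c = s_bar N H * \<delta> - \<alpha> * (\<delta> - (q k - p k))"
  have "AE x in lborel \<Otimes>\<^sub>M ?M. (\<Sum>k\<in>N j. partial_p H j (fst x) (snd x) k) \<le> s_bar N H"
    using AE_sum_partial_le_s_bar[OF H1 j] by (simp add: case_prod_beta)
  then have "AE s in lborel. AE z in ?M. (\<Sum>k\<in>N j. partial_p H j s z k) \<le> s_bar N H"
    by (drule_tac AE_pair) simp
  then have "AE s in lborel. s \<in> {s. H j s q - H j s p \<le> c}"
  proof eventually_elim
    case (elim s)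
    interpret coord_lipschitz "N j" "\<lambda>p. H j s (restrict p (N j))" Lp
      by (rule coord_lipschitz_slice[where \<Psi> = "\<lambda>u p. H j u (restrict p (N j))", OF finite lip[OF j]])
    have partial: "partial_p H j s z l = pderiv_coord l z" if "z \<in> space M" "l \<in> N j" for z l
      unfolding partial_p_def pderiv_coord_def
      using that by (subst restrict_upd_PiE) (auto simp: space_PiM)
    have diff: "AE z in M. (\<lambda>t. H j s (restrict (z(l := t)) (N j))) differentiable (at (z l))"
      and lower: "AE z in M. \<alpha> \<le> pderiv_coord l z" if l: "l \<in> N j" for l
    proof -
      have "AE z in M. (\<lambda>t. H j s (z(l := t))) differentiable (at (z l)) \<and> \<alpha> \<le> partial_p H j s z l"
        using H4i j l unfolding H4i_def by blast
      then have "AE z in M. (\<lambda>t. H j s (restrict (z(l := t)) (N j))) differentiable (at (z l)) \<and> \<alpha> \<le> pderiv_coord l z"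
        using AE_space
      proof eventually_elim
        case (elim z)
        moreover have "restrict (z(l := t)) (N j) = z(l := t)" for t
          using elim(2) l by (intro restrict_upd_PiE) (auto simp: space_PiM)
        ultimately show ?case
          using partial[OF elim(2) l] by simp
      qed
      then show "AE z in M. (\<lambda>t. H j s (restrict (z(l := t)) (N j))) differentiable (at (z l))"
        and "AE z in M. \<alpha> \<le> pderiv_coord l z"
        by (auto elim: eventually_mono)
    qed
    have "AE z in M. \<forall>l\<in>N j. \<alpha> \<le> pderiv_coord l z"
      using lower by (intro AE_finite_allI) auto
    then have "AE z in M. (\<Sum>l\<in>N j. (q l - p l) * pderiv_coord l z) \<le> c"
      using elim AE_space
    proof eventually_elim
      case (elim z)
      let ?d = "\<lambda>l. pderiv_coord l z"
      have nonneg: "(\<delta> - (q l - p l)) * (?d l) \<ge> 0" if "l \<in> N j" for l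
        using that elim(1) \<alpha> \<delta>(2) by (intro mult_nonneg_nonneg) (force elim: order_trans)+
      have "\<alpha> * (\<delta> - (q k - p k)) \<le> (\<delta> - (q k - p k)) * ?d k"
        using elim(1) k \<delta>(2)[OF k] by (subst mult.commute) (intro mult_left_mono; simp)
      also have "\<dots> \<le> (\<Sum>l\<in>N j. (\<delta> - (q l - p l)) * ?d l)"
        by (rule member_le_sum[OF k]) (use nonneg in auto)
      also have "\<dots> = \<delta> * (\<Sum>l\<in>N j. ?d l) - (\<Sum>l\<in>N j. (q l - p l) * ?d l)"
        by (simp add: left_diff_distrib sum_subtractf sum_distrib_left)
      also have "\<delta> * (\<Sum>l\<in>N j. ?d l) \<le> \<delta> * s_bar N H"
        using elim(2) partial[OF elim(3)] \<delta>(1) by (intro mult_left_mono) auto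
      finally show ?case
        unfolding c_def mult.commute[of "s_bar N H" \<delta>] by linarith
    qed
    from ae_mean_value_inequality[OF diff this, of p]
    have "H j s (restrict q (N j)) - H j s (restrict p (N j)) \<le> c"
      by simp
    moreover have "restrict q (N j) = q" "restrict p (N j) = p"
      using p q by (auto simp: PiE_iff intro: extensional_restrict)
    ultimately show ?case by simp
  qed
  then have "AE s in lebesgue. s \<in> {s. H j s q - H j s p \<le> c}"
    by (rule AE_completion)
  moreover have "closed {s. H j s q - H j s p \<le> c}"
  proof -
    have cont: "continuous_on UNIV (\<lambda>s. H j s z)" if z: "z \<in> N j \<rightarrow>\<^sub>E UNIV" for z
    proof -
      have "restrict z (N j) = z"
        using z by (auto simp: PiE_iff intro: extensional_restrict)
      then have *: "\<bar>H j s z - H j t z\<bar> \<le> Lu * \<bar>s - t\<bar>" for s t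
        using lip[OF j, of s z t z] by simp
      have "0 \<le> Lu"
        using *[of 1 0] by simp
      with * show ?thesis
        by (intro lipschitz_on_continuous_on[of Lu]) (auto simp: lipschitz_on_def dist_real_def)
    qed
    show ?thesis
      by (intro closed_Collect_le continuous_on_diff continuous_on_const cont p q)
  qed
  ultimately have "u \<in> {s. H j s q - H j s p \<le> c}"
    by (intro mem_closed_if_AE_lebesgue)
  then show ?thesis
    by (simp add: c_def)
qed

text \<open>The case \<open>p = q\<close>, \<open>\<delta> = 1\<close> of the previous estimate.\<close>

lemma s_bar_ge:
  fixes N :: "'v::finite \<Rightarrow> 'v set"
  assumes "H1 N H" "H4i N H \<alpha>" "\<alpha> \<ge> 0" "inner_nodes N \<noteq> {}"
  shows "\<alpha> \<le> s_bar N H"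
proof -
  obtain j k where j: "j \<in> inner_nodes N" and k: "k \<in> N j"
    using assms(4) by (auto simp: inner_nodes_def)
  obtain p :: "'v \<Rightarrow> real" where p: "p \<in> N j \<rightarrow>\<^sub>E UNIV"
  proof
    show "restrict (\<lambda>_. 0) (N j) \<in> N j \<rightarrow>\<^sub>E UNIV"
      by auto
  qed
  show ?thesis
    using hamiltonian_increment_le[OF assms(1-3) j k p p, of 1] by simp
qed

section \<open>The discrete maximum principle\<close>

lemma dx_bounds:
  fixes N :: "'v::finite \<Rightarrow> 'v set"
  assumes "j \<in> inner_nodes N" "k \<in> N j"
  shows "dx_min N dx \<le> dx j k" "dx j k \<le> dx_max N dx"
proof -
  have "{dx j k | j k. j \<in> inner_nodes N \<and> k \<in> N j} \<subseteq> (\<lambda>(j, k). dx j k) ` UNIV"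
    by auto
  then have "finite {dx j k | j k. j \<in> inner_nodes N \<and> k \<in> N j}"
    by (rule finite_subset) simp
  then show "dx_min N dx \<le> dx j k" "dx j k \<le> dx_max N dx"
    unfolding dx_min_def dx_max_def using assms by (auto intro!: Min_le Max_ge)
qed

lemma dx_min_pos:
  fixes N :: "'v::finite \<Rightarrow> 'v set"
  assumes "inner_nodes N \<noteq> {}" "\<And>j k. k \<in> N j \<Longrightarrow> dx j k > 0"
  shows "dx_min N dx > 0"
proof -
  let ?S = "{dx j k | j k. j \<in> inner_nodes N \<and> k \<in> N j}"
  have "?S \<subseteq> (\<lambda>(j, k). dx j k) ` UNIV"
    by auto
  then have "finite ?S"
    by (rule finite_subset) simp
  moreover have "?S \<noteq> {}"
    using assms(1) by (auto simp: inner_nodes_def)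
  ultimately show ?thesis
    unfolding dx_min_def using assms(2) by (subst Min_gr_iff) auto
qed

lemma exit_path_le_d_inf:
  fixes N :: "'v::finite \<Rightarrow> 'v set"
  assumes "H4ii N" "j \<in> inner_nodes N"
  obtains n where "exit_path N j n" "n \<le> d_inf N"
proof
  show "exit_path N j (bdry_dist N j)"
    using assms by (auto simp: H4ii_def bdry_dist_def intro: LeastI_ex)
  show "bdry_dist N j \<le> d_inf N"
    unfolding d_inf_def using assms(2) by (intro Max_ge) auto
qed

text \<open>
  The quantity \<open>m - (u i - v i)\<close> is the deficit at node \<open>i\<close> with respect to an upper bound \<open>m\<close> for the
  difference \<open>u - v\<close>.  A small deficit at \<open>j\<close> forces the components of the gradient of \<open>v\<close> to exceed
  those of \<open>u\<close> by at most a small \<open>\<delta>\<close>.  If the deficit at a neighbour \<open>k\<close> were large, the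
  component \<open>k\<close> of the gradient of \<open>u\<close> would exceed that of \<open>v\<close> by a large amount, and, as \<open>H\<close> grows
  in this component at rate at least \<open>\<alpha>\<close>, the Hamiltonians would differ by more than \<open>R\<close>.  The first
  argument of \<open>H\<close> only adds to this difference, as \<open>H\<close> is monotone in it and \<open>v j \<le> u j\<close>.
\<close>

lemma deficit_step:
  fixes N :: "'v::finite \<Rightarrow> 'v set"
  assumes H1: "H1 N H" and H2: "H2 N H" and H4i: "H4i N H \<alpha>" and \<alpha>: "\<alpha> > 0"
    and dx_pos: "\<And>j k. k \<in> N j \<Longrightarrow> dx j k > 0"
    and j: "j \<in> inner_nodes N" and k: "k \<in> N j"
    and above: "v j \<le> u j"
    and res: "H j (u j) (gradG N dx u j) - H j (v j) (gradG N dx v j) \<le> R" and R: "R \<ge> 0"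
    and max: "\<And>i. u i - v i \<le> m"
  defines "A \<equiv> dx_max N dx / \<alpha>" and "B \<equiv> s_bar N H / \<alpha> * (dx_max N dx / dx_min N dx)"
  shows "m - (u k - v k) \<le> A * R + (1 + B) * (m - (u j - v j))"
proof -
  let ?p = "gradG N dx u j" and ?q = "gradG N dx v j" and ?w = "\<lambda>i. u i - v i"
  have inner: "inner_nodes N \<noteq> {}"
    using j by auto
  have dmin: "dx_min N dx > 0"
    by (rule dx_min_pos[OF inner dx_pos])
  have s: "s_bar N H \<ge> \<alpha>"
    using s_bar_ge[OF H1 H4i _ inner] \<alpha> by simp
  have carrier: "?p \<in> N j \<rightarrow>\<^sub>E UNIV" "?q \<in> N j \<rightarrow>\<^sub>E UNIV"
    by (auto simp: gradG_def)
  have diff: "?q l - ?p l = (?w l - ?w j) / dx j l" if "l \<in> N j" for l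
    using that by (simp add: gradG_def diff_divide_distrib)
  define \<delta> where "\<delta> = (m - ?w j) / dx_min N dx"
  have \<delta>: "\<delta> \<ge> 0"
    using max[of j] dmin by (simp add: \<delta>_def)
  have le_\<delta>: "?q l - ?p l \<le> \<delta>" if l: "l \<in> N j" for l
  proof -
    have "?q l - ?p l \<le> (m - ?w j) / dx j l"
      unfolding diff[OF l] using dx_pos[OF l] max[of l] by (intro divide_right_mono) auto
    also have "\<dots> \<le> \<delta>"
      unfolding \<delta>_def using dx_bounds(1)[OF j l, of dx] dmin max[of j] by (intro divide_left_mono mult_pos_pos) auto
    finally show ?thesis .
  qed
  have "H j (v j) ?q - H j (v j) ?p \<le> s_bar N H * \<delta> - \<alpha> * (\<delta> - (?q k - ?p k))"
    by (rule hamiltonian_increment_le[OF H1 H4i _ j k carrier \<delta> le_\<delta>]) (use \<alpha> in simp)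
  moreover have "H j (v j) ?p \<le> H j (u j) ?p"
    using H2 j carrier above unfolding H2_def by blast
  moreover have "\<alpha> * \<delta> \<ge> 0"
    using \<alpha> \<delta> by simp
  ultimately have "\<alpha> * (?p k - ?q k) \<le> R + s_bar N H * \<delta>"
    using res by (simp add: algebra_simps)
  moreover have "?p k - ?q k = (?w j - ?w k) / dx j k"
    using diff[OF k] by (simp add: diff_divide_distrib)
  ultimately have "?w j - ?w k \<le> dx j k / \<alpha> * (R + s_bar N H * \<delta>)"
    using \<alpha> dx_pos[OF k] by (simp add: field_simps)
  also have "\<dots> \<le> A * (R + s_bar N H * \<delta>)"
    unfolding A_def using dx_bounds(2)[OF j k, of dx] \<alpha> R s \<delta>
    by (intro mult_right_mono divide_right_mono) auto
  also have "\<dots> = A * R + B * (m - ?w j)"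
    using \<alpha> dmin by (simp add: A_def B_def \<delta>_def field_simps)
  finally show ?thesis
    by (simp add: algebra_simps)
qed

text \<open>
  The deficit with respect to the maximum \<open>m\<close> of \<open>u - v\<close> is followed along a path of length at most
  \<open>d_inf N\<close> from a maximum point to the boundary.  It starts at \<open>0\<close>, and a step takes it from \<open>x\<close> to
  at most \<open>A * R + (1 + B) * x\<close>, so after \<open>i\<close> steps it is at most
  \<open>A * R * ((2 + B) ^ i - 1)\<close>.  At the boundary \<open>u - v\<close> is at most \<open>R / lb\<close>, and \<open>m\<close> is the value there
  plus the deficit.  If \<open>u - v\<close> turns negative on the way, \<open>m\<close> is already smaller than the deficit at
  that node.
\<close>

lemma one_sided_stability:
  fixes N :: "'v::finite \<Rightarrow> 'v set"
  assumes H1: "H1 N H" and H2: "H2 N H" and H4i: "H4i N H \<alpha>" and \<alpha>: "\<alpha> > 0"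
    and H4ii: "H4ii N" and inner_ne: "inner_nodes N \<noteq> {}"
    and dx_pos: "\<And>j k. k \<in> N j \<Longrightarrow> dx j k > 0" and lb: "lb > 0"
    and inner: "\<And>j. j \<in> inner_nodes N \<Longrightarrow> H j (u j) (gradG N dx u j) - H j (v j) (gradG N dx v j) \<le> R"
    and bdry: "\<And>j. j \<in> bdry_nodes N \<Longrightarrow> lb * (u j - v j) \<le> R" and R: "R \<ge> 0"
  shows "u i - v i \<le>
    (dx_max N dx / \<alpha> * (2 + s_bar N H / \<alpha> * (dx_max N dx / dx_min N dx)) ^ d_inf N + 1 / lb) * R"
proof -
  define A where "A = dx_max N dx / \<alpha>"
  define B where "B = s_bar N H / \<alpha> * (dx_max N dx / dx_min N dx)"
  define w where "w = (\<lambda>j. u j - v j)"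
  define m where "m = Max (range w)"
  have w_le: "w j \<le> m" for j
    by (simp add: m_def)
  obtain j where j: "w j = m"
    unfolding m_def using Max_in[of "range w"] by fastforce
  obtain j' k' where "j' \<in> inner_nodes N" "k' \<in> N j'"
    using inner_ne by (auto simp: inner_nodes_def)
  then have "0 < dx_max N dx"
    using dx_bounds(2)[of j' N k' dx] dx_pos[of k' j'] by linarith
  then have A: "A \<ge> 0"
    using \<alpha> by (simp add: A_def)
  have "dx_min N dx > 0"
    by (rule dx_min_pos[OF inner_ne dx_pos])
  then have B: "B \<ge> 0"
    using s_bar_ge[OF H1 H4i _ inner_ne] \<alpha> \<open>0 < dx_max N dx\<close> by (simp add: B_def)
  have mono: "A * R * ((2 + B) ^ n - 1) \<le> A * R * (2 + B) ^ d_inf N" if "n \<le> d_inf N" for n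
  proof -
    have "(2 + B) ^ n \<le> (2 + B) ^ d_inf N"
      using that B by (intro power_increasing) auto
    then show ?thesis
      using A R by (intro mult_left_mono) auto
  qed
  have step: "m - w k \<le> A * R + (1 + B) * (m - w l)"
    if "l \<in> inner_nodes N" "k \<in> N l" "w l \<ge> 0" for k l
    unfolding A_def B_def w_def
    by (rule deficit_step[OF H1 H2 H4i \<alpha> dx_pos that(1,2) _ inner[OF that(1)] R])
       (use that(3) w_le in \<open>auto simp: w_def\<close>)
  have bdry': "w l \<le> 1 / lb * R" if "l \<in> bdry_nodes N" for l
    using bdry[OF that] lb by (simp add: w_def field_simps)
  have lbR: "1 / lb * R \<ge> 0"
    using lb R by simp
  have "m \<le> A * R * (2 + B) ^ d_inf N + 1 / lb * R"
  proof (cases "j \<in> inner_nodes N")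
    case False
    then have "m \<le> 1 / lb * R"
      using bdry'[of j] j by (simp add: inner_nodes_def bdry_nodes_def)
    moreover have "A * R * (2 + B) ^ d_inf N \<ge> 0"
      using A B R by simp
    ultimately show ?thesis by linarith
  next
    case True
    then obtain n where "exit_path N j n" and n: "n \<le> d_inf N"
      using exit_path_le_d_inf[OF H4ii] by blast
    then obtain js where js: "js 1 = j" "\<And>i. i \<in> {1..n} \<Longrightarrow> js i \<in> inner_nodes N"
        "js (n + 1) \<in> bdry_nodes N" "\<And>i. i \<in> {1..n} \<Longrightarrow> js (i + 1) \<in> N (js i)"
      unfolding exit_path_def by blast
    show ?thesis
    proof (rule ccontr)
      assume contra: "\<not> ?thesis"
      have "m - w (js (i + 1)) \<le> A * R * ((2 + B) ^ i - 1)" if "i \<le> n" for i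
        using that
      proof (induction i)
        case 0
        then show ?case using js(1) j by simp
      next
        case (Suc i)
        then have IH: "m - w (js (i + 1)) \<le> A * R * ((2 + B) ^ i - 1)"
          by simp
        \<comment> \<open>A negative value would bound \<open>m\<close> by the deficit at this node.\<close>
        have "w (js (i + 1)) \<ge> 0"
          using IH mono[of i] Suc.prems n contra lbR by linarith
        then have "m - w (js (Suc i + 1)) \<le> A * R + (1 + B) * (m - w (js (i + 1)))"
          using js(2)[of "i + 1"] js(4)[of "i + 1"] Suc.prems by (intro step) auto
        also have "\<dots> \<le> A * R + (1 + B) * (A * R * ((2 + B) ^ i - 1))"
          using IH B by (intro add_left_mono mult_left_mono) auto
        also have "\<dots> = A * R * ((2 + B) ^ Suc i - 1) - A * R * ((2 + B) ^ i + B - 1)"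
          by (simp add: algebra_simps)
        also have "\<dots> \<le> A * R * ((2 + B) ^ Suc i - 1)"
        proof -
          have "(2 + B) ^ i + B - 1 \<ge> 0"
            using B one_le_power[of "2 + B" i] by linarith
          then have "A * R * ((2 + B) ^ i + B - 1) \<ge> 0"
            using A R by simp
          then show ?thesis
            by linarith
        qed
        finally show ?case .
      qed
      from this[of n] mono[OF n] bdry'[OF js(3)] contra show False
        by linarith
    qed
  qed
  then have "m \<le> (A * (2 + B) ^ d_inf N + 1 / lb) * R"
    by (simp add: algebra_simps)
  with w_le[of i] show ?thesis
    unfolding A_def B_def w_def by linarith
qed

text \<open>
  The residual bounds hold in absolute value, so the one-sided estimate applies both to \<open>(u, ubar)\<close>
  and to \<open>(ubar, u)\<close>.
\<close>

theorem theorem5: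
  fixes N :: "'v::finite \<Rightarrow> 'v set"
    and dx :: "'v \<Rightarrow> 'v \<Rightarrow> real"
    and H :: "'v \<Rightarrow> real \<Rightarrow> ('v \<Rightarrow> real) \<Rightarrow> real"
    and g u ubar :: "'v \<Rightarrow> real"
    and lb \<alpha> :: real
  assumes no_loops: "\<And>j. j \<notin> N j"
    and inner_nonempty: "inner_nodes N \<noteq> {}"
    and bdry_nonempty: "bdry_nodes N \<noteq> {}"
    and dx_pos: "\<And>j k. k \<in> N j \<Longrightarrow> dx j k > 0"
    and lb_pos: "lb > 0"
    and H1: "H1 N H"
    and H2: "H2 N H"
    and alpha_pos: "\<alpha> > 0"
    and H4i: "H4i N H \<alpha>"
    and H4ii: "H4ii N"
    and H4iii: "H4iii N"
    and sol: "residual N dx H lb g ubar = (\<lambda>j. 0)"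
  shows "linf_norm (\<lambda>j. u j - ubar j) \<le>
    (dx_max N dx / \<alpha> * (2 + s_bar N H / \<alpha> * (dx_max N dx / dx_min N dx)) ^ d_inf N + 1 / lb)
      * linf_norm (residual N dx H lb g u)"
proof -
  define R where "R = linf_norm (residual N dx H lb g u)"
  have R_ge: "\<bar>residual N dx H lb g u j\<bar> \<le> R" for j
    unfolding R_def linf_norm_def by (rule Max_ge) auto
  have R: "R \<ge> 0"
    using R_ge[of undefined] by linarith
  have solj: "residual N dx H lb g ubar j = 0" for j
    by (simp add: sol)
  have inner: "\<bar>H j (u j) (gradG N dx u j) - H j (ubar j) (gradG N dx ubar j)\<bar> \<le> R"
    if "j \<in> inner_nodes N" for j
    using R_ge[of j] solj[of j] that by (simp add: residual_def)
  have bdry: "\<bar>lb * (u j - ubar j)\<bar> \<le> R" if "j \<in> bdry_nodes N" for j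
    using R_ge[of j] solj[of j] that lb_pos
    by (simp add: residual_def inner_nodes_def bdry_nodes_def)
  note stability = one_sided_stability[OF H1 H2 H4i alpha_pos H4ii inner_nonempty dx_pos lb_pos _ _ R]
  have "u j - ubar j \<le> (dx_max N dx / \<alpha> * (2 + s_bar N H / \<alpha> * (dx_max N dx / dx_min N dx)) ^ d_inf N + 1 / lb) * R" for j
    by (rule stability) (use inner bdry in \<open>auto dest: abs_le_D1\<close>)
  moreover have "ubar j - u j \<le> (dx_max N dx / \<alpha> * (2 + s_bar N H / \<alpha> * (dx_max N dx / dx_min N dx)) ^ d_inf N + 1 / lb) * R" for j
    by (rule stability) (use inner bdry in \<open>fastforce dest: abs_le_D2 simp: algebra_simps\<close>)+
  ultimately show ?thesis
    unfolding R_def[symmetric] linf_norm_def[of "\<lambda>j. u j - ubar j"]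
    by (subst Max_le_iff) (auto simp: abs_le_iff)
qed

end
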